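(* Let $m, r_2 \geq 3$, let $P \in \{X, Y, Z\}$ and $Q \in \{X,Y,Z\}$, and let $\Gamma = PQ(m,r_2)$ be the sggi of rank $m + r_2$ obtained by gluing $P(m)$ to the dual of $Q(r_2)$ (so $\Gamma$ is any of $XX(m,r_2)$, $XY(m,r_2)$, $XZ(m,r_2)$, $YX(m,r_2)$, $YY(m,r_2)$, $YZ(m,r_2)$, $ZX(m,r_2)$, $ZY(m,r_2)$, $ZZ(m,r_2)$). Then $\Gamma$ is a string C-group isomorphic to $A_n$ for $n = 2m+2r_2+3$.
   Context: A rank $r$ sggi is a group $\langle \rho_0, \ldots, \rho_{r-1}\rangle$ with a distinguished ordered tuple of generators satisfying $\rho_i^2 = 1$ for all $i$ and $(\rho_i\rho_j)^2 = 1$ whenever $|i-j| \geq 2$. It is a string C-group if $\langle \rho_i \mid i \in I\rangle \cap \langle \rho_j \mid j \in J\rangle = \langle \rho_k \mid k \in I\cap J\rangle$ for all $I, J \subseteq \{0,\ldots,r-1\}$. For $k \geq 3$, $X(k)$, $Y(k)$, $Z(k)$ are the rank $k$ sggis generated by the following permutations of $\{1,\ldots,2k+2\}$. For $0 \le i \le k-1$ put $h_i = (2i+1,2i+3)(2i+2,2i+4)$. $X(k)$: $\rho_i = h_i$ for $i \neq 2$, and $\rho_2 = (1,2)(3,4)\,h_2$. $Y(k)$: $\rho_0 = (1,2)(3,4)$, $\rho_1 = h_1$, $\rho_2 = (1,3)(2,4)\,h_2$, and $\rho_i = h_i$ for $3 \leq i \leq k-1$. $Z(k)$: $\rho_0 =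 (1,4)(2,3)$, $\rho_1 = h_1$, $\rho_2 = (1,3)(2,4)\,h_2$, and $\rho_i = h_i$ for $3 \leq i \leq k-1$. In each case the point $2k+2$ is moved only by $\rho_{k-1}$. Gluing: let $P(m) = \langle \rho_0,\ldots,\rho_{m-1}\rangle$ act on its $2m+2$ points, and let $Q(r_2) = \langle \sigma_0,\ldots,\sigma_{r_2-1}\rangle$ act on its $2r_2+2$ points. Take the disjoint union of the two point sets and identify the point $2m+2$ of the first with the point $2r_2+2$ of the second, giving a set of $2m+2r_2+3$ points. $PQ(m,r_2) = \langle \phi_0,\ldots,\phi_{m+r_2-1}\rangle$, where for $0\le i<m$, $\phi_i$ acts as $\rho_i$ on the points of $P(m)$ and fixes all other points, and for $m \leq i < m+r_2$, $\phi_i$ acts as $\sigma_{m+r_2-1-i}$ on the points of $Q(r_2)$ and fixes all other points. *)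

theory Defs
  imports "HOL-Algebra.Sym_Groups" "HOL-Algebra.Elementary_Groups"
begin

text \<open>A rank \<open>r\<close> sggi is a group together with an ordered tuple \<open>\<rho> 0, \<dots>, \<rho> (r - 1)\<close> of
  distinguished generators; the values of \<open>\<rho>\<close> at indices \<open>\<ge> r\<close> play no role.\<close>

definition sggi :: "('a, 'b) monoid_scheme \<Rightarrow> nat \<Rightarrow> (nat \<Rightarrow> 'a) \<Rightarrow> bool" where
  "sggi G r \<rho> \<longleftrightarrow>
     group G \<and>
     (\<forall>i<r. \<rho> i \<in> carrier G) \<and>
     carrier G = generate G (\<rho> ` {..<r}) \<and>
     (\<forall>i<r. \<rho> i [^]\<^bsub>G\<^esub> (2::nat) = \<one>\<^bsub>G\<^esub>) \<and>
     (\<forall>i<r. \<forall>j<r. \<bar>int i - int j\<bar> \<ge> 2 \<longrightarrow>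
        (\<rho> i \<otimes>\<^bsub>G\<^esub> \<rho> j) [^]\<^bsub>G\<^esub> (2::nat) = \<one>\<^bsub>G\<^esub>)"

definition string_C_group :: "('a, 'b) monoid_scheme \<Rightarrow> nat \<Rightarrow> (nat \<Rightarrow> 'a) \<Rightarrow> bool" where
  "string_C_group G r \<rho> \<longleftrightarrow>
     sggi G r \<rho> \<and>
     (\<forall>I J. I \<subseteq> {..<r} \<longrightarrow> J \<subseteq> {..<r} \<longrightarrow>
        generate G (\<rho> ` I) \<inter> generate G (\<rho> ` J) = generate G (\<rho> ` (I \<inter> J)))"

datatype family = FX | FY | FZ

definition hgen :: "nat \<Rightarrow> nat \<Rightarrow> nat" where
  "hgen i = Transposition.transpose (2*i + 1) (2*i + 3) \<circ> Transposition.transpose (2*i + 2) (2*i + 4)"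

text \<open>The generators \<open>\<rho> 0, \<dots>, \<rho> (k - 1)\<close> of \<open>X(k)\<close>, \<open>Y(k)\<close>, \<open>Z(k)\<close>, as permutations of
  \<open>{1..2*k + 2}\<close> extended by the identity. The formulas do not depend on \<open>k\<close>, which only
  bounds the index.\<close>

fun family_gen :: "family \<Rightarrow> nat \<Rightarrow> nat \<Rightarrow> nat" where
  "family_gen FX i =
     (if i = 2 then Transposition.transpose 1 2 \<circ> Transposition.transpose 3 4 \<circ> hgen 2 else hgen i)"
| "family_gen FY i =
     (if i = 0 then Transposition.transpose 1 2 \<circ> Transposition.transpose 3 4
      else if i = 2 then Transposition.transpose 1 3 \<circ> Transposition.transpose 2 4 \<circ> hgen 2
      else hgen i)"
| "family_gen FZ i =
     (if i = 0 then Transposition.transpose 1 4 \<circ> Transposition.transpose 2 3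
      else if i = 2 then Transposition.transpose 1 3 \<circ> Transposition.transpose 2 4 \<circ> hgen 2
      else hgen i)"

definition points :: "nat \<Rightarrow> nat set" where
  "points k = {1..2*k + 2}"

text \<open>The glued point set is labelled by \<open>{1..2*m + 2*r2 + 3}\<close>: the points of \<open>P(m)\<close> keep their
  labels, the points \<open>j\<close> of \<open>Q(r2)\<close> are shifted by \<open>2*m + 2\<close>, except that the last one is
  identified with the last point of \<open>P(m)\<close>.\<close>

definition left_point :: "nat \<Rightarrow> nat" where
  "left_point j = j"

definition right_point :: "nat \<Rightarrow> nat \<Rightarrow> nat \<Rightarrow> nat" where
  "right_point m r2 j = (if j = 2*r2 + 2 then 2*m + 2 else 2*m + 2 + j)"

lemma inj_on_left_point: "inj_on left_point (points m)"
  by (simp add: inj_on_def left_point_def)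

lemma inj_on_right_point: "inj_on (right_point m r2) (points r2)"
  by (auto simp: inj_on_def right_point_def points_def)

lemma left_right_point_eq_iff:
  assumes "i \<in> points m" "j \<in> points r2"
  shows "left_point i = right_point m r2 j \<longleftrightarrow> i = 2*m + 2 \<and> j = 2*r2 + 2"
  using assms by (auto simp: left_point_def right_point_def points_def)

lemma glued_points:
  "left_point ` points m \<union> right_point m r2 ` points r2 = {1..2*m + 2*r2 + 3}"
proof (intro equalityI subsetI)
  fix x
  assume "x \<in> left_point ` points m \<union> right_point m r2 ` points r2"
  then show "x \<in> {1..2*m + 2*r2 + 3}"
    by (auto simp: left_point_def right_point_def points_def)
next
  fix x
  assume x: "x \<in> {1..2*m + 2*r2 + 3}"
  show "x \<in> left_point ` points m \<union> right_point m r2 ` points r2"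
  proof (cases "x \<le> 2*m + 2")
    case True
    then show ?thesis
      using x by (simp add: left_point_def points_def)
  next
    case False
    then have "x = right_point m r2 (x - (2*m + 2))" "x - (2*m + 2) \<in> points r2"
      using x by (simp_all add: right_point_def points_def) linarith+
    then show ?thesis
      by blast
  qed
qed

text \<open>\<open>act_along e S p\<close> acts on \<open>e ` S\<close> as \<open>p\<close> acts on \<open>S\<close>, and fixes every other point
  (\<open>e\<close> injective on \<open>S\<close>).\<close>

definition act_along :: "('a \<Rightarrow> 'b) \<Rightarrow> 'a set \<Rightarrow> ('a \<Rightarrow> 'a) \<Rightarrow> 'b \<Rightarrow> 'b" where
  "act_along e S p x = (if x \<in> e ` S then e (p (inv_into S e x)) else x)"

definition glued_gen :: "family \<Rightarrow> family \<Rightarrow> nat \<Rightarrow> nat \<Rightarrow> nat \<Rightarrow> nat \<Rightarrow> nat" where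
  "glued_gen P Q m r2 i =
     (if i < m then act_along left_point (points m) (family_gen P i)
      else act_along (right_point m r2) (points r2) (family_gen Q (m + r2 - 1 - i)))"

definition glued_group :: "family \<Rightarrow> family \<Rightarrow> nat \<Rightarrow> nat \<Rightarrow> (nat \<Rightarrow> nat) monoid" where
  "glued_group P Q m r2 =
     subgroup_generated (sym_group (2*m + 2*r2 + 3)) (glued_gen P Q m r2 ` {..<m + r2})"

end

theory Submission
  imports Defs
begin

text \<open>
  Arrange the points of a piece \<open>X(k)\<close>, \<open>Y(k)\<close> or \<open>Z(k)\<close> in a ladder of \<open>k + 1\<close> columns of two points.
  All generators preserve the columns, and the two pieces share one point \<open>c\<close>, the bottom point of the
  last column of each. Only the last generator of a piece moves \<open>c\<close>.

  The shared point makes the group large. The supports of the two generators that move \<open>c\<close> meet in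
  \<open>c\<close> only, so their commutator is a 3-cycle. Each generator fixes one of the three points of this
  cycle, and this suffices to spread it: a subgroup generated by some of the generators, these two
  among them, contains the alternating group of its orbit of \<open>c\<close> (\<open>cross_contains_alternating\<close>).
  The full group is transitive and consists of even permutations, so it is the alternating group
  (\<open>glue_alternating\<close>).

  For a string of involutions the intersection property follows from the case of an interval of
  indices and a final interval that starts one index later (\<open>intersection_property_from_intervals\<close>).
  If both intervals contain the two generators at the junction, an element of the intersection agrees
  outside the orbit of \<open>c\<close> with a product of one element from each side. The quotient is an even
  permutation of that orbit, and all of these are available (\<open>cross_Int\<close>). In the other cases the
  intersection lies in one of the pieces. Two facts about a piece are needed then, its own
  intersection property and a tightness condition (locale \<open>end_piece\<close>): an element that is trivial
  outside the orbit of \<open>c\<close> under a final segment of the generators is generated by that segment.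

  Both facts about the pieces are computations with permutations of columns and sets of columns that
  are turned upside down. The generators from index \<open>3\<close> on generate symmetric groups of columns, and
  the generators from index \<open>2\<close> on add at most one central involution. Once generator \<open>3\<close> takes part,
  the subgroups are as large as the shape of the generators permits, which leaves a few small groups
  on at most four columns; these are controlled by invariant partitions of the first eight points
  (\<open>par_1_3_pair\<close>, \<open>interval_0_Z\<close>) or by a relabelling that identifies the group
  (\<open>tilt\<close>). The tightness condition is immediate when the orbit of \<open>c\<close> stays in the bottom row, and
  in the one remaining case it is the description of the stabilizer of a column (\<open>stabilizer_X\<close>).
\<close>

section \<open>Groups generated by involutions\<close>

text \<open>The monoid generated by a set of involutions is already a group, so its elements are products of
generators, without inverses. Working with products of plain functions keeps group
carriers out of all arguments but the last one.\<close>
inductive_set words :: "('a \<Rightarrow> 'a) set \<Rightarrow> ('a \<Rightarrow> 'a) set" for S where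
  words_id: "id \<in> words S"
| words_step: "s \<in> S \<Longrightarrow> g \<in> words S \<Longrightarrow> s \<circ> g \<in> words S"

lemma words_gen: "s \<in> S \<Longrightarrow> s \<in> words S"
  using words_step[OF _ words_id, of s S] by simp

lemma words_comp: "g \<in> words S \<Longrightarrow> h \<in> words S \<Longrightarrow> g \<circ> h \<in> words S"
  by (induction rule: words.induct) (auto simp: comp_assoc intro: words_step)

lemma words_subset:
  assumes "S \<subseteq> words T" shows "words S \<subseteq> words T"
proof
  fix g assume "g \<in> words S"
  then show "g \<in> words T"
  proof induction
    case (words_step s g)
    then show ?case using assms words_comp by blast
  qed (rule words_id)
qed

lemma words_mono: "S \<subseteq> T \<Longrightarrow> words S \<subseteq> words T"
  by (rule words_subset) (auto intro: words_gen)

lemma words_empty [simp]: "words {} = {id}"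
proof -
  have "g = id" if "g \<in> words {}" for g :: "'a \<Rightarrow> 'a"
    using that by cases auto
  then show ?thesis by (auto intro: words_id)
qed

lemma words_image:
  assumes "g \<in> words S" "\<And>s y. s \<in> S \<Longrightarrow> y \<in> X \<Longrightarrow> s y \<in> X" "x \<in> X"
  shows "g x \<in> X"
  using assms by induction auto

lemma words_fixes:
  assumes "g \<in> words S" "\<And>s. s \<in> S \<Longrightarrow> s x = x"
  shows "g x = x"
  using assms by induction auto

lemma words_inv:
  assumes "g \<in> words S" "\<And>s. s \<in> S \<Longrightarrow> s \<circ> s = id"
  shows "bij g \<and> inv' g \<in> words S"
  using assms
proof induction
  case words_id
  show ?case by (metis bij_id inv_id words.words_id)
next
  case (words_step s g)
  have s: "bij s" "inv' s = s"
    using words_step.prems[OF words_step.hyps(1)] o_bij inv_unique_comp by blast+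
  have g: "bij g" "inv' g \<in> words S" using words_step by auto
  then show ?case
    using s words_comp[OF g(2) words_gen[OF words_step.hyps(1)]]
    by (metis bij_comp o_inv_distrib)
qed

lemma words_permutes:
  assumes "g \<in> words S" "\<And>s. s \<in> S \<Longrightarrow> s permutes A"
  shows "g permutes A"
  using assms by induction (auto intro: permutes_compose permutes_id)

lemma words_even:
  assumes "g \<in> words S" "finite A" "\<And>s. s \<in> S \<Longrightarrow> s permutes A \<and> evenperm s"
  shows "evenperm g"
  using assms(1)
proof induction
  case (words_step s g)
  then have "g permutes A" using words_permutes assms(3) by blast
  then have "permutation g" "permutation s"
    using assms words_step by (auto simp: permutation_permutes)
  then show ?case using evenperm_comp words_step assms(3) by blast
qed simp

text \<open>If the letters of \<open>S\<close> commute with those of \<open>T\<close>, then a word can be sorted: every new letter from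
\<open>T\<close> moves past the part that is written in \<open>S\<close>.\<close>
lemma words_Un_commuting:
  assumes "g \<in> words (S \<union> T)" "\<And>s t. s \<in> S \<Longrightarrow> t \<in> T \<Longrightarrow> s \<circ> t = t \<circ> s"
  shows "\<exists>a\<in>words S. \<exists>b\<in>words T. g = a \<circ> b"
  using assms(1)
proof induction
  case words_id
  show ?case by (rule bexI[of _ id], rule bexI[of _ id]) (auto intro: words.words_id)
next
  case (words_step s g)
  then obtain a b where ab: "a \<in> words S" "b \<in> words T" "g = a \<circ> b" by blast
  have past: "t \<circ> a = a \<circ> t" if "t \<in> T" for t
    using ab(1)
  proof induction
    case (words_step s' a')
    then show ?case using assms(2)[OF words_step(1) that] by (metis comp_assoc)
  qed simp
  from words_step(1) show ?case
  proof
    assume "s \<in> S"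
    then show ?thesis using ab words.words_step[of s S a] by (metis comp_assoc)
  next
    assume "s \<in> T"
    then have "s \<circ> g = a \<circ> (s \<circ> b)" using past ab(3) by (metis comp_assoc)
    then show ?thesis using ab words.words_step[OF \<open>s \<in> T\<close> ab(2)] by blast
  qed
qed

section \<open>The intersection property from intervals of indices\<close>

abbreviation par :: "(nat \<Rightarrow> 'a \<Rightarrow> 'a) \<Rightarrow> nat set \<Rightarrow> ('a \<Rightarrow> 'a) set" where
  "par \<rho> I \<equiv> words (\<rho> ` I)"

lemma par_mono: "I \<subseteq> J \<Longrightarrow> par \<rho> I \<subseteq> par \<rho> J"
  by (intro words_mono image_mono)

definition intersection_property :: "(nat \<Rightarrow> 'a \<Rightarrow> 'a) \<Rightarrow> nat \<Rightarrow> bool" where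
  "intersection_property \<rho> N \<longleftrightarrow>
     (\<forall>I J. I \<subseteq> {..<N} \<longrightarrow> J \<subseteq> {..<N} \<longrightarrow> par \<rho> I \<inter> par \<rho> J = par \<rho> (I \<inter> J))"

text \<open>In a string of generators, those of the maximal run that starts at \<open>a\<close> commute with all the
remaining ones, because the index that ends the run is left out.\<close>
lemma initial_run:
  fixes a N :: nat
  assumes "a \<in> I" "I \<subseteq> {a..<N}"
  obtains s I' where "a \<le> s" "s < N" "I = {a..s} \<union> I'" "I' \<subseteq> {s+2..<N}"
proof -
  define u where "u = (LEAST u. a \<le> u \<and> u \<notin> I)"
  have ex: "a \<le> N \<and> N \<notin> I" using assms by force
  have u: "a \<le> u" "u \<notin> I" using LeastI[of "\<lambda>u. a \<le> u \<and> u \<notin> I", OF ex] unfolding u_def by auto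
  have below: "x \<in> I" if "a \<le> x" "x < u" for x
    using not_less_Least[of x "\<lambda>u. a \<le> u \<and> u \<notin> I"] that unfolding u_def by auto
  have "a < u" using u assms by (metis le_neq_implies_less)
  have le: "u \<le> N" using Least_le[of "\<lambda>u. a \<le> u \<and> u \<notin> I", OF ex] unfolding u_def by simp
  have split: "x \<in> {a..u-1} \<union> (I \<inter> {u+1..<N})" if "x \<in> I" for x
  proof -
    have "a \<le> x" "x < N" "x \<noteq> u" using that assms u by auto
    then show ?thesis using that by auto
  qed
  show thesis
  proof (rule that[of "u-1" "I \<inter> {u+1..<N}"])
    show "I = {a..u-1} \<union> (I \<inter> {u+1..<N})"
    proof (intro equalityI subsetI)
      show "x \<in> I" if "x \<in> {a..u-1} \<union> (I \<inter> {u+1..<N})" for x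
        using that below[of x] \<open>a < u\<close> by auto
    qed (fact split)
  qed (use \<open>a < u\<close> le in auto)
qed

text \<open>Downward induction on the least index \<open>a\<close> that may occur in \<open>I\<close> or \<open>J\<close>. Let \<open>a \<in> I\<close>, and write
\<open>g = x \<circ> y\<close> with \<open>x\<close> from the initial run \<open>{a..s}\<close> of \<open>I\<close> and \<open>y\<close> from the rest of \<open>I\<close>. If \<open>a \<notin> J\<close>,
then \<open>g\<close> and \<open>y\<close> are generated by later indices, hence so is \<open>x\<close>; the hypothesis on intervals
removes \<open>a\<close> from the run, and the induction hypothesis applies. If \<open>a\<close> lies in both sets, then
the shorter one of the two initial runs lies in \<open>I \<inter> J\<close>, and dividing by its factor leads back to the first case.\<close>
lemma intersection_property_from_intervals:
  fixes \<rho> :: "nat \<Rightarrow> 'a \<Rightarrow> 'a"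
  assumes invol: "\<And>i. i < N \<Longrightarrow> \<rho> i \<circ> \<rho> i = id"
    and comm: "\<And>i j. i + 2 \<le> j \<Longrightarrow> j < N \<Longrightarrow> \<rho> i \<circ> \<rho> j = \<rho> j \<circ> \<rho> i"
    and intv: "\<And>k s. k \<le> s \<Longrightarrow> s < N \<Longrightarrow> par \<rho> {k<..<N} \<inter> par \<rho> {k..s} \<subseteq> par \<rho> {k<..s}"
  shows "intersection_property \<rho> N"
proof -
  have inv: "bij g \<and> inv' g \<in> par \<rho> I" if "g \<in> par \<rho> I" "I \<subseteq> {..<N}" for g I
    using that invol by (intro words_inv) auto
  have "\<forall>I J. I \<subseteq> {a..<N} \<longrightarrow> J \<subseteq> {a..<N} \<longrightarrow> par \<rho> I \<inter> par \<rho> J \<subseteq> par \<rho> (I \<inter> J)"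
    if "a \<le> N" for a
    using that
  proof (induction rule: inc_induct)
    case base
    show ?case by (auto simp: words_id)
  next
    case (step a)
    have split: "\<exists>x\<in>par \<rho> {a..s}. \<exists>y\<in>par \<rho> I'. g = x \<circ> y"
      if "g \<in> par \<rho> ({a..s} \<union> I')" "I' \<subseteq> {s+2..<N}" for g s I'
    proof (rule words_Un_commuting)
      show "g \<in> words (\<rho> ` {a..s} \<union> \<rho> ` I')" using that(1) by (simp add: image_Un)
      fix u v assume "u \<in> \<rho> ` {a..s}" "v \<in> \<rho> ` I'"
      then obtain i j where "i \<le> s" "j \<in> I'" "u = \<rho> i" "v = \<rho> j" by auto
      moreover have "i + 2 \<le> j" "j < N" using calculation that(2) by (auto dest!: subsetD)
      ultimately show "u \<circ> v = v \<circ> u" using comm by blast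
    qed
    have one: "g \<in> par \<rho> (I \<inter> J)"
      if I: "I \<subseteq> {a..<N}" "a \<in> I" and J: "J \<subseteq> {Suc a..<N}"
        and g: "g \<in> par \<rho> I" "g \<in> par \<rho> J" for g I J
    proof -
      obtain s I' where s: "a \<le> s" "s < N" "I = {a..s} \<union> I'" "I' \<subseteq> {s+2..<N}"
        using initial_run[OF I(2,1)] .
      obtain x y where xy: "x \<in> par \<rho> {a..s}" "y \<in> par \<rho> I'" "g = x \<circ> y"
        using split g(1) s(3,4) by blast
      have below: "{a<..<N} \<subseteq> {..<N}" by auto
      have J': "J \<subseteq> {a<..<N}" and I': "I' \<subseteq> {a<..<N}" using J s by auto
      have y: "bij y" "inv' y \<in> par \<rho> I'" using inv[OF xy(2)] I' below by blast+
      have "x = g \<circ> inv' y" by (rule ext) (simp add: xy(3) bij_is_surj[OF y(1)] surj_f_inv_f)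
      moreover have "g \<circ> inv' y \<in> par \<rho> {a<..<N}"
        using g(2) y(2) par_mono[OF J'] par_mono[OF I'] by (blast intro: words_comp)
      ultimately have "x \<in> par \<rho> {a<..s}" using intv[OF s(1,2)] xy(1) by blast
      note x = this
      have "g \<in> par \<rho> (I - {a})"
        unfolding xy(3)
      proof (rule words_comp)
        show "x \<in> par \<rho> (I - {a})"
          by (rule subsetD[OF par_mono x]) (use s in auto)
        show "y \<in> par \<rho> (I - {a})"
          by (rule subsetD[OF par_mono xy(2)]) (use s in auto)
      qed
      moreover have "I - {a} \<subseteq> {Suc a..<N}" using I by force
      ultimately have "g \<in> par \<rho> ((I - {a}) \<inter> J)" using step.IH J g(2) by blast
      moreover have "(I - {a}) \<inter> J = I \<inter> J" using J by force
      ultimately show ?thesis by simp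
    qed
    have both: "g \<in> par \<rho> (I \<inter> J)"
      if I: "I = {a..s} \<union> I'" "I' \<subseteq> {s+2..<N}" and J: "J = {a..t} \<union> J'" "J' \<subseteq> {t+2..<N}"
        and st: "a \<le> t" "t \<le> s" "s < N"
        and g: "g \<in> par \<rho> I" "g \<in> par \<rho> J" for g I J s t I' J'
    proof -
      obtain v u where vu: "v \<in> par \<rho> {a..t}" "u \<in> par \<rho> J'" "g = v \<circ> u"
        using split g(2) J by blast
      have v: "v \<in> par \<rho> (I \<inter> J)"
        by (rule subsetD[OF par_mono vu(1)]) (use st I J in auto)
      have "{a..t} \<subseteq> {..<N}" using st by auto
      then have "bij v" "inv' v \<in> par \<rho> {a..t}" using inv[OF vu(1)] by auto
      moreover have "{a..t} \<subseteq> I" using I st by auto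
      ultimately have "bij v" "inv' v \<in> par \<rho> I" using par_mono by blast+
      moreover have "u = inv' v \<circ> g"
        by (rule ext) (simp add: vu(3) bij_is_inj[OF \<open>bij v\<close>])
      ultimately have "u \<in> par \<rho> I" using g(1) by (auto intro: words_comp)
      then have "u \<in> par \<rho> (I \<inter> J')"
        using one[of I J' u] vu(2) I J st by force
      then have "u \<in> par \<rho> (I \<inter> J)" using J par_mono[of "I \<inter> J'" "I \<inter> J"] by blast
      then show ?thesis using v vu(3) by (auto intro: words_comp)
    qed
    show ?case
    proof (intro allI impI subsetI)
      fix I J g assume IJ: "I \<subseteq> {a..<N}" "J \<subseteq> {a..<N}" and "g \<in> par \<rho> I \<inter> par \<rho> J"
      then have g: "g \<in> par \<rho> I" "g \<in> par \<rho> J" by blast+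
      have tail: "K \<subseteq> {Suc a..<N}" if "K \<subseteq> {a..<N}" "a \<notin> K" for K
      proof
        fix x assume "x \<in> K"
        then have "a \<le> x" "x < N" "x \<noteq> a" using that by auto
        then show "x \<in> {Suc a..<N}" by auto
      qed
      consider "a \<in> I" "a \<in> J" | "a \<in> I" "a \<notin> J" | "a \<notin> I" "a \<in> J" | "a \<notin> I" "a \<notin> J" by blast
      then show "g \<in> par \<rho> (I \<inter> J)"
      proof cases
        case 1
        obtain s I' where s: "a \<le> s" "s < N" "I = {a..s} \<union> I'" "I' \<subseteq> {s+2..<N}"
          using initial_run[OF 1(1) IJ(1)] .
        obtain t J' where t: "a \<le> t" "t < N" "J = {a..t} \<union> J'" "J' \<subseteq> {t+2..<N}"
          using initial_run[OF 1(2) IJ(2)] .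
        show ?thesis
        proof (cases "t \<le> s")
          case True
          show ?thesis by (rule both[OF s(3,4) t(3,4) t(1) True s(2) g])
        next
          case False
          then have "s \<le> t" by simp
          from both[OF t(3,4) s(3,4) s(1) this t(2) g(2,1)] show ?thesis by (simp only: Int_commute)
        qed
      next
        case 2
        show ?thesis by (rule one[OF IJ(1) 2(1) tail[OF IJ(2) 2(2)] g])
      next
        case 3
        show ?thesis using one[OF IJ(2) 3(2) tail[OF IJ(1) 3(1)] g(2,1)] by (simp only: Int_commute)
      next
        case 4
        have "par \<rho> I \<inter> par \<rho> J \<subseteq> par \<rho> (I \<inter> J)"
          using step.IH tail[OF IJ(1) 4(1)] tail[OF IJ(2) 4(2)] by simp
        then show ?thesis by (rule subsetD) (use g in simp)
      qed
    qed
  qed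
  from this[of 0] show ?thesis
    unfolding intersection_property_def atLeast0LessThan
    by (intro allI impI equalityI Int_greatest par_mono Int_lower1 Int_lower2) blast
qed

section \<open>Alternating groups from a single 3-cycle\<close>

text \<open>The product of transpositions is the 3-cycle \<open>a \<mapsto> b \<mapsto> c \<mapsto> a\<close>.\<close>
definition triple :: "('a \<Rightarrow> 'a) set \<Rightarrow> 'a \<Rightarrow> 'a \<Rightarrow> 'a \<Rightarrow> bool" where
  "triple G a b c \<longleftrightarrow> a \<noteq> b \<and> b \<noteq> c \<and> a \<noteq> c \<and> transpose a b \<circ> transpose b c \<in> G"

text \<open>Two permutations whose supports share exactly one point have a 3-cycle as their commutator; for
involutions the commutator is \<open>f \<circ> h \<circ> f \<circ> h\<close>.\<close>
lemma commutator_three_cycle: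
  assumes "\<And>p. f (f p) = p" "\<And>p. h (h p) = p"
    and "\<And>p. f p \<noteq> p \<Longrightarrow> h p \<noteq> p \<Longrightarrow> p = c0" and "f c0 \<noteq> c0" "h c0 \<noteq> c0"
  shows "f \<circ> h \<circ> f \<circ> h = transpose c0 (f c0) \<circ> transpose (f c0) (h c0)"
proof
  fix p
  have x: "h (f c0) = f c0" using assms by metis
  have z: "f (h c0) = h c0" using assms by metis
  have ne: "f c0 \<noteq> h c0" using assms x by metis
  consider "p = c0" | "p = f c0" | "p = h c0" | "p \<noteq> c0" "p \<noteq> f c0" "p \<noteq> h c0" by blast
  then show "(f \<circ> h \<circ> f \<circ> h) p = (transpose c0 (f c0) \<circ> transpose (f c0) (h c0)) p"
  proof cases
    case 4
    have "f (h (f (h p))) = p" using 4 assms by metis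
    then show ?thesis using 4 by simp
  qed (use assms(1,2,4,5) x z ne in \<open>simp_all add: transpose_def\<close>)
qed

locale permutation_group =
  fixes G :: "('a \<Rightarrow> 'a) set"
  assumes comp: "g \<in> G \<Longrightarrow> h \<in> G \<Longrightarrow> g \<circ> h \<in> G"
    and inv: "g \<in> G \<Longrightarrow> bij g \<and> inv' g \<in> G"
    and one: "id \<in> G"
begin

lemma triple_conj:
  assumes "g \<in> G" "triple G a b c" shows "triple G (g a) (g b) (g c)"
proof -
  have g: "bij g" "inv' g \<in> G" using inv assms by auto
  have "g \<circ> (transpose a b \<circ> transpose b c) \<circ> inv' g \<in> G"
    using comp[OF comp[OF assms(1)] g(2)] assms(2) unfolding triple_def by blast
  moreover have "g \<circ> (transpose a b \<circ> transpose b c) \<circ> inv' g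
      = transpose (g a) (g b) \<circ> transpose (g b) (g c)"
  proof
    fix p
    obtain q where "p = g q" using g(1) by (metis bij_pointE)
    then show "(g \<circ> (transpose a b \<circ> transpose b c) \<circ> inv' g) p
      = (transpose (g a) (g b) \<circ> transpose (g b) (g c)) p"
      using bij_is_inj[OF g(1)] by (simp add: transpose_def inj_eq)
  qed
  ultimately show ?thesis
    using assms(2) bij_is_inj[OF g(1)] unfolding triple_def by (simp add: inj_eq)
qed

lemma triple_rotate: "triple G a b c \<Longrightarrow> triple G b c a"
proof -
  assume t: "triple G a b c"
  then have "transpose a b \<circ> transpose b c = transpose b c \<circ> transpose c a"
    unfolding triple_def by (intro ext) (auto simp: transpose_def)
  then show ?thesis using t unfolding triple_def by auto
qed

lemma triple_reverse: "triple G a b c \<Longrightarrow> triple G c b a"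
proof -
  assume t: "triple G a b c"
  have "inv' (transpose a b \<circ> transpose b c) = transpose b c \<circ> transpose a b"
    by (simp add: o_inv_distrib)
  then show ?thesis using t inv unfolding triple_def by (metis transpose_commute)
qed

lemma triple_swap: "triple G a b c \<Longrightarrow> triple G b a c"
  using triple_rotate triple_reverse by blast

text \<open>Conjugation by the 3-cycle \<open>a \<mapsto> x \<mapsto> y \<mapsto> a\<close> moves \<open>a\<close> to \<open>x\<close> and fixes \<open>b\<close> and \<open>c\<close>.\<close>
lemma triple_replace:
  assumes "triple G a b c" "triple G a x y" "b \<noteq> x" "b \<noteq> y" "c \<noteq> x" "c \<noteq> y"
  shows "triple G x b c"
proof -
  have "triple G ((transpose a x \<circ> transpose x y) a) ((transpose a x \<circ> transpose x y) b)
    ((transpose a x \<circ> transpose x y) c)"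
    using triple_conj[OF _ assms(1), of "transpose a x \<circ> transpose x y"] assms(2)
    unfolding triple_def[of G a x y] by blast
  then show ?thesis using assms unfolding triple_def by (simp add: transpose_def split: if_splits)
qed

text \<open>If \<open>G\<close> has a 3-cycle on the three points of \<open>D\<close>, then it contains all 3-cycles on this set
(lemma \<open>triple_reach\<close>), and each element of \<open>G\<close> that fixes a point of \<open>D\<close> preserves this set
(lemma \<open>reach_invariant\<close>). So no primitivity argument is needed to find an alternating group.\<close>
definition reach :: "'a set \<Rightarrow> 'a set" where
  "reach D = D \<union> {p. \<exists>a\<in>D. \<exists>b\<in>D. triple G a b p}"

context
  fixes u v w :: 'a
  assumes uvw: "triple G u v w"
begin

lemma base_triple:
  assumes "a \<in> {u,v,w}" "b \<in> {u,v,w}" "c \<in> {u,v,w}" "a \<noteq> b" "b \<noteq> c" "a \<noteq> c"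
  shows "triple G a b c"
  using assms uvw triple_rotate triple_swap by blast

lemma third_point:
  assumes "a \<in> {u,v,w}" "b \<in> {u,v,w}"
  obtains c where "c \<in> {u,v,w}" "c \<noteq> a" "c \<noteq> b"
  using assms uvw unfolding triple_def by blast

text \<open>The 3-cycle on \<open>{u, v, w}\<close> permutes the three pairs of its points cyclically, so a single pair that
forms a 3-cycle with \<open>p\<close> yields all of them.\<close>
lemma one_outside:
  assumes p: "p \<in> reach {u,v,w}" "p \<notin> {u,v,w}"
    and ab: "a \<in> {u,v,w}" "b \<in> {u,v,w}" "a \<noteq> b"
  shows "triple G a b p"
proof -
  obtain d e where de: "d \<in> {u,v,w}" "e \<in> {u,v,w}" "triple G d e p"
    using p unfolding reach_def by blast
  then have "d \<noteq> e" unfolding triple_def by blast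
  obtain c where c: "c \<in> {u,v,w}" "c \<noteq> d" "c \<noteq> e" using third_point de by blast
  have t: "triple G d e c" using base_triple c de \<open>d \<noteq> e\<close> by blast
  have "triple G ((transpose d e \<circ> transpose e c) d) ((transpose d e \<circ> transpose e c) e)
    ((transpose d e \<circ> transpose e c) p)"
    using triple_conj[OF _ de(3), of "transpose d e \<circ> transpose e c"] t
    unfolding triple_def[of G d e c] by blast
  then have 1: "triple G e c p"
    using c de \<open>d \<noteq> e\<close> p(2) by (auto simp: transpose_def split: if_splits)
  have t': "triple G e c d" using t triple_rotate by blast
  have "triple G ((transpose e c \<circ> transpose c d) e) ((transpose e c \<circ> transpose c d) c)
    ((transpose e c \<circ> transpose c d) p)"
    using triple_conj[OF _ 1, of "transpose e c \<circ> transpose c d"] t'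
    unfolding triple_def[of G e c d] by blast
  then have 2: "triple G c d p"
    using c de \<open>d \<noteq> e\<close> p(2) by (auto simp: transpose_def split: if_splits)
  have "{u,v,w} = {d,e,c}" using c de \<open>d \<noteq> e\<close> by auto
  then show ?thesis using ab 1 2 de(3) triple_swap by auto
qed

lemma two_outside:
  assumes "p \<in> reach {u,v,w} - {u,v,w}" "q \<in> reach {u,v,w} - {u,v,w}" "p \<noteq> q" "a \<in> {u,v,w}"
  shows "triple G a p q"
proof -
  obtain b where b: "b \<in> {u,v,w}" "b \<noteq> a" using third_point assms(4) by blast
  obtain c where c: "c \<in> {u,v,w}" "c \<noteq> a" "c \<noteq> b" using third_point assms(4) b by blast
  have "triple G b a q" "triple G b p c"
    using one_outside[of q b a] one_outside[of p c b] assms b c triple_rotate by blast+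
  then have "triple G p a q"
    using triple_replace[of b a q p c] assms b c by blast
  then show ?thesis using triple_swap by blast
qed

lemma three_outside:
  assumes "p \<in> reach {u,v,w} - {u,v,w}" "q \<in> reach {u,v,w} - {u,v,w}" "r \<in> reach {u,v,w} - {u,v,w}"
    "p \<noteq> q" "p \<noteq> r" "q \<noteq> r"
  shows "triple G p q r"
proof -
  obtain b where b: "b \<in> {u,v,w}" "b \<noteq> u" using third_point by blast
  have "triple G u q r" using two_outside assms by blast
  moreover have "triple G u p b" using one_outside[of p b u] assms b triple_rotate by blast
  ultimately show ?thesis using triple_replace[of u q r p b] assms b by blast
qed

lemma triple_reach:
  assumes "p \<in> reach {u,v,w}" "q \<in> reach {u,v,w}" "r \<in> reach {u,v,w}"
    "p \<noteq> q" "p \<noteq> r" "q \<noteq> r"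
  shows "triple G p q r"
proof -
  define D where "D = {u,v,w}"
  note D = D_def[symmetric]
  consider "p \<in> D" "q \<in> D" "r \<in> D" | "p \<in> D" "q \<in> D" "r \<notin> D"
    | "p \<in> D" "q \<notin> D" "r \<in> D" | "p \<notin> D" "q \<in> D" "r \<in> D"
    | "p \<in> D" "q \<notin> D" "r \<notin> D" | "p \<notin> D" "q \<in> D" "r \<notin> D"
    | "p \<notin> D" "q \<notin> D" "r \<in> D" | "p \<notin> D" "q \<notin> D" "r \<notin> D" by argo
  then show ?thesis
  proof cases
    case 1 then show ?thesis using base_triple[unfolded D] assms(4-6) by blast
  next
    case 2 then show ?thesis using one_outside[unfolded D, of r p q] assms[unfolded D] by blast
  next
    case 3 then show ?thesis using one_outside[unfolded D, of q r p] assms[unfolded D] triple_rotate by blast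
  next
    case 4 then show ?thesis using one_outside[unfolded D, of p q r] assms[unfolded D] triple_rotate by blast
  next
    case 5 then show ?thesis using two_outside[unfolded D, of q r p] assms[unfolded D] by blast
  next
    case 6 then show ?thesis using two_outside[unfolded D, of r p q] assms[unfolded D] triple_rotate by blast
  next
    case 7 then show ?thesis using two_outside[unfolded D, of p q r] assms[unfolded D] triple_rotate by blast
  next
    case 8 then show ?thesis using three_outside[unfolded D] assms[unfolded D] by blast
  qed
qed

text \<open>If the 3-cycle on \<open>f, d, e\<close> meets \<open>{u, v, w} = {f, b, c}\<close> only in \<open>f\<close>, then it carries the 3-cycle on
\<open>f, b, c\<close> to one on \<open>d, b, c\<close>.\<close>
lemma reach_from_fixed:
  assumes f: "f \<in> {u,v,w}" and t: "triple G f d e"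
  shows "d \<in> reach {u,v,w}"
proof -
  consider "d \<in> {u,v,w}" | "e \<in> {u,v,w}" | "d \<notin> {u,v,w}" "e \<notin> {u,v,w}" by blast
  then show ?thesis
  proof cases
    case 1 then show ?thesis unfolding reach_def by blast
  next
    case 2
    have "triple G f e d" using t triple_rotate triple_swap by blast
    then show ?thesis using 2 f unfolding reach_def by blast
  next
    case 3
    obtain b where b: "b \<in> {u,v,w}" "b \<noteq> f" using third_point f by blast
    obtain c where c: "c \<in> {u,v,w}" "c \<noteq> f" "c \<noteq> b" using third_point f b by blast
    have "triple G d b c" using triple_replace[of f b c d e] base_triple[of f b c] 3 f b c t by blast
    then have "triple G b c d" using triple_rotate by blast
    then show ?thesis using b c unfolding reach_def by blast
  qed
qed

lemma reach_invariant:
  assumes g: "g \<in> G" "f \<in> {u,v,w}" "g f = f" and p: "p \<in> reach {u,v,w}"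
  shows "g p \<in> reach {u,v,w}"
proof (cases "p = f")
  case True
  then show ?thesis using g unfolding reach_def by auto
next
  case False
  obtain a where a: "a \<in> {u,v,w}" "a \<noteq> f" "a \<noteq> p"
  proof (cases "p \<in> {u,v,w}")
    case True then show thesis using third_point[OF g(2) True] that by blast
  next
    case outside: False
    then show thesis using third_point[OF g(2) g(2)] that by blast
  qed
  have "f \<in> reach {u,v,w}" "a \<in> reach {u,v,w}" using a g unfolding reach_def by auto
  then have "triple G f p a" using triple_reach p False a by blast
  then have "triple G f (g p) (g a)" using triple_conj[OF g(1)] g(3) by metis
  then show ?thesis using reach_from_fixed g(2) by blast
qed

end

text \<open>An even permutation is a product of pairs of transpositions, and a pair of transpositions is a
product of at most two 3-cycles. The induction runs over single transpositions, so it carries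
along a statement for odd permutations too.\<close>
lemma even_perm_in:
  assumes t: "\<And>p q r. p \<in> X \<Longrightarrow> q \<in> X \<Longrightarrow> r \<in> X \<Longrightarrow> p \<noteq> q \<Longrightarrow> p \<noteq> r \<Longrightarrow> q \<noteq> r \<Longrightarrow> triple G p q r"
    and h: "h permutes X" "finite X" "evenperm h"
  shows "h \<in> G"
proof -
  have chain: "transpose a b \<circ> transpose b c \<in> G"
    if "a \<in> X" "b \<in> X" "c \<in> X" "a \<noteq> b" "b \<noteq> c" for a b c
  proof (cases "a = c")
    case True
    then have "transpose a b \<circ> transpose b c = id" by (metis transpose_commute transpose_comp_involutory)
    then show ?thesis using one by metis
  next
    case False
    then show ?thesis using t that unfolding triple_def by blast
  qed
  have two: "transpose a b \<circ> transpose c d \<in> G"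
    if "a \<in> X" "b \<in> X" "c \<in> X" "d \<in> X" "a \<noteq> b" "c \<noteq> d" for a b c d
  proof (cases "b = c")
    case False
    have "transpose a b \<circ> transpose c d
        = (transpose a b \<circ> transpose b c) \<circ> (transpose b c \<circ> transpose c d)"
      by (rule ext) simp
    then show ?thesis using comp chain that False by metis
  qed (use chain that in blast)
  have "(evenperm h \<longrightarrow> h \<in> G) \<and>
    (\<not> evenperm h \<longrightarrow> (\<forall>a\<in>X. \<forall>b\<in>X. a \<noteq> b \<longrightarrow> transpose a b \<circ> h \<in> G))"
    using h(1,2)
  proof (induction rule: permutes_induct)
    case id
    show ?case using one evenperm_id by blast
  next
    case (swap a b q)
    have "permutation q" using swap h(2) by (auto simp: permutation_permutes)
    then have ev: "evenperm (transpose a b \<circ> q) \<longleftrightarrow> \<not> evenperm q"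
      using evenperm_comp[OF permutation_swap_id[of a b], of q] swap(3) by (simp add: evenperm_swap)
    show ?case
    proof (cases "evenperm q")
      case True
      then have "transpose c d \<circ> (transpose a b \<circ> q) \<in> G"
        if "c \<in> X" "d \<in> X" "c \<noteq> d" for c d
        using comp[OF two[of c d a b], of q] swap that by (metis comp_assoc)
      then show ?thesis using ev True by blast
    next
      case False
      then show ?thesis using ev swap by blast
    qed
  qed
  then show ?thesis using h(3) by simp
qed

end

section \<open>Gluing two generating sequences at a point\<close>

definition word_orbit :: "('a \<Rightarrow> 'a) set \<Rightarrow> 'a \<Rightarrow> 'a set" where
  "word_orbit S x = (\<lambda>g. g x) ` words S"

lemma word_orbit_refl: "x \<in> word_orbit S x"
  unfolding word_orbit_def by (rule image_eqI[OF _ words_id]) simp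

lemma word_orbit_apply: "g \<in> words S \<Longrightarrow> y \<in> word_orbit S x \<Longrightarrow> g y \<in> word_orbit S x"
proof -
  assume g: "g \<in> words S" and "y \<in> word_orbit S x"
  then obtain h where "h \<in> words S" "y = h x" unfolding word_orbit_def by blast
  then show ?thesis
    unfolding word_orbit_def using words_comp[OF g] by (intro image_eqI[of _ _ "g \<circ> h"]) auto
qed

lemma word_orbit_subset:
  assumes "\<And>s y. s \<in> S \<Longrightarrow> y \<in> X \<Longrightarrow> s y \<in> X" "x \<in> X"
  shows "word_orbit S x \<subseteq> X"
proof
  fix y assume "y \<in> word_orbit S x"
  then obtain g where "g \<in> words S" "y = g x" unfolding word_orbit_def by blast
  then show "y \<in> X" using words_image[of g S X x] assms by blast
qed

text \<open>Follow a point of \<open>A\<close> outside the \<open>S\<close>-orbit of \<open>c\<close> through a word in \<open>S \<union> T\<close>: it never reaches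
\<open>c\<close>, so the letters from \<open>T\<close> do not move it.\<close>
lemma restrict_to_side:
  assumes "g \<in> words (S \<union> T)"
    and S: "\<And>s. s \<in> S \<Longrightarrow> s permutes A" "\<And>s. s \<in> S \<Longrightarrow> s \<circ> s = id"
    and T: "\<And>t x. t \<in> T \<Longrightarrow> x \<in> A \<Longrightarrow> x \<noteq> c \<Longrightarrow> t x = x"
  shows "\<exists>p\<in>words S. \<forall>x\<in>A - word_orbit S c. g x = p x"
  using assms(1)
proof induction
  case words_id
  then show ?case using words.words_id by blast
next
  case (words_step s g)
  then obtain p where p: "p \<in> words S" "\<forall>x\<in>A - word_orbit S c. g x = p x" by blast
  from words_step(1) show ?case
  proof
    assume "s \<in> S"
    then show ?thesis using p by (intro bexI[of _ "s \<circ> p"] words.words_step) auto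
  next
    assume "s \<in> T"
    have "s (p x) = p x" if x: "x \<in> A - word_orbit S c" for x
    proof -
      have "p permutes A" using words_permutes p(1) S(1) by blast
      then have "p x \<in> A" using x by (simp add: permutes_in_image)
      moreover have "p x \<notin> word_orbit S c"
      proof
        assume px: "p x \<in> word_orbit S c"
        have p': "bij p \<and> inv' p \<in> words S" by (rule words_inv[OF p(1)]) (rule S(2))
        then have "inv' p (p x) \<in> word_orbit S c" using word_orbit_apply[OF _ px] by blast
        then show False using x p' by (simp add: bij_is_inj)
      qed
      ultimately show ?thesis using T[OF \<open>s \<in> T\<close>, of "p x"] word_orbit_refl[of c S] by metis
    qed
    then show ?thesis using p by (intro bexI[of _ p]) auto
  qed
qed

text \<open>One side of the glued sequence: a string of even involutions on \<open>A\<close> of which only the last one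
moves the point \<open>c\<close>, where the other side will be attached. The glued group acts on the orbit of
\<open>c\<close> in an arbitrary way, so an element of one side is visible only through its action outside that
orbit. The last condition says that this does not lose information: an element of the whole group
that is trivial outside the orbit of \<open>c\<close> under a final segment of the generators belongs to the
subgroup generated by that segment.\<close>
locale end_piece =
  fixes A :: "'a set" and c :: 'a and \<rho> :: "nat \<Rightarrow> 'a \<Rightarrow> 'a" and m :: nat
  assumes finite: "finite A" and c_in: "c \<in> A" and m_pos: "m > 0"
    and permutes: "i < m \<Longrightarrow> \<rho> i permutes A"
    and even: "i < m \<Longrightarrow> evenperm (\<rho> i)"
    and invol: "i < m \<Longrightarrow> \<rho> i \<circ> \<rho> i = id"
    and comm: "i + 2 \<le> j \<Longrightarrow> j < m \<Longrightarrow> \<rho> i \<circ> \<rho> j = \<rho> j \<circ> \<rho> i"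
    and fixes_c: "i + 1 < m \<Longrightarrow> \<rho> i c = c"
    and moves_c: "\<rho> (m - 1) c \<noteq> c"
    and intersection: "intersection_property \<rho> m"
    and tight: "k < m \<Longrightarrow> g \<in> par \<rho> {..<m} \<Longrightarrow>
        (\<And>x. x \<in> A \<Longrightarrow> x \<notin> word_orbit (\<rho> ` {k..<m}) c \<Longrightarrow> g x = x) \<Longrightarrow> g \<in> par \<rho> {k..<m}"
begin

lemma par_inv:
  assumes "g \<in> par \<rho> I" "I \<subseteq> {..<m}"
  shows "bij g" "inv' g \<in> par \<rho> I"
  using words_inv[OF assms(1)] assms(2) invol by blast+

lemma par_permutes: "g \<in> par \<rho> I \<Longrightarrow> I \<subseteq> {..<m} \<Longrightarrow> g permutes A"
  using words_permutes permutes by blast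

lemma orbit_subset: "word_orbit (\<rho> ` {k..<m}) c \<subseteq> A"
proof (rule word_orbit_subset)
  show "s y \<in> A" if "s \<in> \<rho> ` {k..<m}" "y \<in> A" for s y
    using that permutes by (auto simp: permutes_in_image)
qed (rule c_in)

lemma par_Int:
  "g \<in> par \<rho> I \<Longrightarrow> g \<in> par \<rho> J \<Longrightarrow> I \<subseteq> {..<m} \<Longrightarrow> J \<subseteq> {..<m} \<Longrightarrow> I \<inter> J \<subseteq> K \<Longrightarrow> g \<in> par \<rho> K"
  using intersection par_mono[of "I \<inter> J" K \<rho>] unfolding intersection_property_def by blast

lemma tight_mod:
  assumes "k < m" and g: "g \<in> par \<rho> {..<m}" and p: "p \<in> par \<rho> {k..<m}"
    and eq: "\<And>x. x \<in> A - word_orbit (\<rho> ` {k..<m}) c \<Longrightarrow> g x = p x"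
  shows "g \<in> par \<rho> {k..<m}"
proof -
  have sub: "{k..<m} \<subseteq> {..<m}" by auto
  have p': "bij p" "inv' p \<in> par \<rho> {k..<m}" using par_inv[OF p sub] by auto
  have "inv' p \<circ> g \<in> par \<rho> {k..<m}"
  proof (rule tight[OF assms(1)])
    show "inv' p \<circ> g \<in> par \<rho> {..<m}"
      using p'(2) par_mono[OF sub] g by (blast intro: words_comp)
    show "(inv' p \<circ> g) x = x" if "x \<in> A" "x \<notin> word_orbit (\<rho> ` {k..<m}) c" for x
      using eq[of x] that p'(1) by (simp add: bij_is_inj)
  qed
  then have "p \<circ> (inv' p \<circ> g) \<in> par \<rho> {k..<m}" using p by (blast intro: words_comp)
  moreover have "p \<circ> (inv' p \<circ> g) = g"
    by (rule ext) (simp add: bij_is_surj[OF p'(1)] surj_f_inv_f)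
  ultimately show ?thesis by simp
qed

end

text \<open>The second sequence is attached in reverse order, so that the two generators that move \<open>c\<close> become
neighbours. The groups \<open>cross k j\<close> are those generated by the intervals of indices that contain both
of them.\<close>
locale glued = L: end_piece A c \<sigma> m + R: end_piece B c \<tau> r
  for A B :: "'a set" and c and \<sigma> \<tau> :: "nat \<Rightarrow> 'a \<Rightarrow> 'a" and m r :: nat +
  assumes meet: "A \<inter> B = {c}"
begin

definition glue :: "nat \<Rightarrow> 'a \<Rightarrow> 'a" where
  "glue i = (if i < m then \<sigma> i else \<tau> (m + r - 1 - i))"

abbreviation cross :: "nat \<Rightarrow> nat \<Rightarrow> ('a \<Rightarrow> 'a) set" where
  "cross k j \<equiv> words (\<sigma> ` {k..<m} \<union> \<tau> ` {j..<r})"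

abbreviation W :: "nat \<Rightarrow> 'a set" where "W k \<equiv> word_orbit (\<sigma> ` {k..<m}) c"
abbreviation V :: "nat \<Rightarrow> 'a set" where "V j \<equiv> word_orbit (\<tau> ` {j..<r}) c"

lemma left_fixes: "p \<in> par \<sigma> I \<Longrightarrow> I \<subseteq> {..<m} \<Longrightarrow> x \<in> B \<Longrightarrow> x \<noteq> c \<Longrightarrow> p x = x"
  using L.par_permutes meet unfolding permutes_def by blast

lemma right_fixes: "q \<in> par \<tau> J \<Longrightarrow> J \<subseteq> {..<r} \<Longrightarrow> x \<in> A \<Longrightarrow> x \<noteq> c \<Longrightarrow> q x = x"
  using R.par_permutes meet unfolding permutes_def by blast

lemma left_gen_fixes: "i < m \<Longrightarrow> x \<in> B \<Longrightarrow> x \<noteq> c \<Longrightarrow> \<sigma> i x = x"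
  using L.permutes meet unfolding permutes_def by blast

lemma right_gen_fixes: "j < r \<Longrightarrow> x \<in> A \<Longrightarrow> x \<noteq> c \<Longrightarrow> \<tau> j x = x"
  using R.permutes meet unfolding permutes_def by blast

text \<open>Outside the orbit of \<open>c\<close>, a group that crosses the junction acts as each of its sides does on its own.\<close>
lemma cross_left:
  assumes "g \<in> cross k j"
  shows "\<exists>p\<in>par \<sigma> {k..<m}. \<forall>x\<in>A - W k. g x = p x"
proof (rule restrict_to_side[OF assms])
  show "s permutes A" "s \<circ> s = id" if "s \<in> \<sigma> ` {k..<m}" for s
    using that L.permutes L.invol by auto
  show "t x = x" if "t \<in> \<tau> ` {j..<r}" "x \<in> A" "x \<noteq> c" for t x
    using that right_gen_fixes by auto
qed

lemma cross_right:
  assumes "g \<in> cross k j"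
  shows "\<exists>q\<in>par \<tau> {j..<r}. \<forall>x\<in>B - V j. g x = q x"
proof (rule restrict_to_side[of g _ "\<sigma> ` {k..<m}"])
  show "g \<in> words (\<tau> ` {j..<r} \<union> \<sigma> ` {k..<m})" using assms by (simp add: Un_commute)
  show "s permutes B" "s \<circ> s = id" if "s \<in> \<tau> ` {j..<r}" for s
    using that R.permutes R.invol by auto
  show "t x = x" if "t \<in> \<sigma> ` {k..<m}" "x \<in> B" "x \<noteq> c" for t x
    using that left_gen_fixes by auto
qed

lemma cross_gen:
  assumes "s \<in> \<sigma> ` {k..<m} \<union> \<tau> ` {j..<r}"
  shows "s permutes A \<union> B \<and> evenperm s" "s \<circ> s = id"
proof -
  from assms consider i where "i < m" "s = \<sigma> i" | i where "i < r" "s = \<tau> i" by auto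
  then show "s permutes A \<union> B \<and> evenperm s"
  proof cases
    case 1
    then show ?thesis using L.permutes L.even permutes_subset[of s A "A \<union> B"] by auto
  next
    case 2
    then show ?thesis using R.permutes R.even permutes_subset[of s B "A \<union> B"] by auto
  qed
  from assms show "s \<circ> s = id" using L.invol R.invol by auto
qed

lemma cross_even:
  assumes "g \<in> cross k j" shows "g permutes A \<union> B" "evenperm g"
  using words_permutes[OF assms] words_even[OF assms, of "A \<union> B"] cross_gen L.finite R.finite
  by blast+

text \<open>The supports of the two generators next to the junction share only \<open>c\<close>, so their commutator is a
3-cycle on \<open>c\<close>, a point of \<open>A\<close> and a point of \<open>B\<close>. Every generator fixes one of these three points:
those of the left side fix the point of \<open>B\<close>, those of the right side the point of \<open>A\<close>. Hence the
3-cycle spreads over the whole orbit of \<open>c\<close>.\<close>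
lemma cross_contains_alternating:
  assumes kj: "k < m" "j < r" and h: "h permutes W k \<union> V j" "evenperm h"
  shows "h \<in> cross k j"
proof -
  interpret permutation_group "cross k j"
  proof
    show "bij g \<and> inv' g \<in> cross k j" if "g \<in> cross k j" for g
      using words_inv[OF that] cross_gen(2) by blast
  qed (auto intro: words_comp words_id)
  let ?f = "\<sigma> (m - 1)" and ?h = "\<tau> (r - 1)"
  let ?v = "?f c" and ?w = "?h c"
  have lt: "m - 1 < m" "r - 1 < r" using kj by auto
  have ins: "?v \<in> A" "?w \<in> B" "?v \<noteq> c" "?w \<noteq> c"
    using L.permutes[OF lt(1)] R.permutes[OF lt(2)] L.c_in R.c_in L.moves_c R.moves_c
    by (auto simp: permutes_in_image)
  have gens: "?f \<in> cross k j" "?h \<in> cross k j"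
    using kj by (auto intro!: words_gen)
  have "?f \<circ> ?h \<circ> ?f \<circ> ?h = transpose c ?v \<circ> transpose ?v ?w"
  proof (rule commutator_three_cycle)
    show "?f (?f p) = p" "?h (?h p) = p" for p
      using L.invol[OF lt(1)] R.invol[OF lt(2)] by (metis comp_apply id_apply)+
    show "p = c" if "?f p \<noteq> p" "?h p \<noteq> p" for p
      using that L.permutes[OF lt(1)] R.permutes[OF lt(2)] meet unfolding permutes_def by blast
  qed (use L.moves_c R.moves_c in auto)
  then have "transpose c ?v \<circ> transpose ?v ?w \<in> cross k j"
    using comp[OF comp[OF comp[OF gens] gens(1)] gens(2)] by metis
  moreover have "?v \<noteq> ?w"
  proof
    assume "?v = ?w"
    then have "?v \<in> A \<inter> B" using ins by simp
    then show False using meet ins by simp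
  qed
  ultimately have uvw: "triple (cross k j) c ?v ?w"
    using ins(3,4) unfolding triple_def by metis
  have inv_gen: "s y \<in> reach {c,?v,?w}"
    if s: "s \<in> \<sigma> ` {k..<m} \<union> \<tau> ` {j..<r}" and y: "y \<in> reach {c,?v,?w}" for s y
  proof -
    have "\<exists>f\<in>{c,?v,?w}. s f = f"
    proof -
      from s consider i where "i < m" "s = \<sigma> i" | i where "i < r" "s = \<tau> i" by auto
      then show ?thesis
      proof cases
        case 1
        then have "s ?w = ?w" using left_gen_fixes ins by blast
        then show ?thesis by blast
      next
        case 2
        then have "s ?v = ?v" using right_gen_fixes ins by blast
        then show ?thesis by blast
      qed
    qed
    then show ?thesis using reach_invariant[OF uvw words_gen[OF s]] y by blast
  qed
  have c: "c \<in> reach {c,?v,?w}" unfolding reach_def by simp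
  have "W k \<subseteq> reach {c,?v,?w}" "V j \<subseteq> reach {c,?v,?w}"
    by (rule word_orbit_subset[OF _ c], rule inv_gen; blast)+
  then show ?thesis
    using even_perm_in[OF _ h(1) _ h(2)] triple_reach[OF uvw]
      finite_subset[OF L.orbit_subset L.finite] finite_subset[OF R.orbit_subset R.finite]
    by (meson Un_least finite_UnI subsetD)
qed

text \<open>On \<open>A\<close> the element \<open>g\<close> acts outside the orbit of \<open>c\<close> as some \<open>p\<close> from the smaller left segment, and
on \<open>B\<close> as some \<open>q\<close> from the smaller right segment. After division by \<open>p\<close> and \<open>q\<close> it is an even
permutation of the orbit of \<open>c\<close> under \<open>cross k' j\<close>, which contains all of these.\<close>
lemma cross_Int:
  assumes kj: "k' < m" "k \<le> k'" "j < r" and g: "g \<in> cross k' i" "g \<in> cross k j" and "i \<le> j"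
  shows "g \<in> cross k' j"
proof -
  obtain p where p: "p \<in> par \<sigma> {k'..<m}" "\<And>x. x \<in> A - W k' \<Longrightarrow> g x = p x"
    using cross_left[OF g(1)] by blast
  obtain q where q: "q \<in> par \<tau> {j..<r}" "\<And>x. x \<in> B - V j \<Longrightarrow> g x = q x"
    using cross_right[OF g(2)] by blast
  have sub: "{k'..<m} \<subseteq> {..<m}" "{j..<r} \<subseteq> {..<r}" by auto
  note p' = L.par_inv[OF p(1) sub(1)] and q' = R.par_inv[OF q(1) sub(2)]
  have cWV: "c \<in> W k'" "c \<in> V j" by (simp_all add: word_orbit_refl)
  have pc: "p \<in> cross k' j" and qc: "q \<in> cross k' j"
    and pc': "inv' p \<in> cross k' j" and qc': "inv' q \<in> cross k' j"
    using p(1) q(1) p'(2) q'(2) words_mono[of "\<sigma> ` {k'..<m}" "\<sigma> ` {k'..<m} \<union> \<tau> ` {j..<r}"]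
      words_mono[of "\<tau> ` {j..<r}" "\<sigma> ` {k'..<m} \<union> \<tau> ` {j..<r}"] by blast+
  define h where "h = inv' q \<circ> (inv' p \<circ> g)"
  have "h \<in> words (\<sigma> ` {k..<m} \<union> \<tau> ` {j..<r})"
  proof -
    have "cross k' j \<subseteq> cross k j" using kj by (intro words_mono) auto
    then show ?thesis unfolding h_def using pc' qc' g(2) by (blast intro: words_comp)
  qed
  then have even: "evenperm h" "h permutes A \<union> B" using cross_even by blast+
  have fixA: "h x = x" if "x \<in> A" "x \<notin> W k'" for x
  proof -
    have "x \<noteq> c" using that cWV by blast
    then show ?thesis
      using p(2)[of x] that right_fixes[OF q'(2) sub(2)] p'(1) unfolding h_def
      by (simp add: bij_is_inj)
  qed
  have fixB: "h x = x" if "x \<in> B" "x \<notin> V j" for x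
  proof -
    have "x \<noteq> c" using that cWV by blast
    have "q permutes B" using R.par_permutes[OF q(1) sub(2)] .
    then have "q x \<in> B" using that by (simp add: permutes_in_image)
    have "q x \<noteq> c"
    proof
      assume "q x = c"
      then have "inv' q c = x" using q'(1) by (metis bij_is_inj inv_f_f)
      then show False using word_orbit_apply[OF q'(2) cWV(2)] that(2) by simp
    qed
    then show ?thesis
      using q(2)[of x] that left_fixes[OF p'(2) sub(1) \<open>q x \<in> B\<close>] q'(1) unfolding h_def
      by (simp add: bij_is_inj)
  qed
  have "h permutes W k' \<union> V j"
  proof (rule permutes_superset[OF even(2)])
    show "h x = x" if "x \<in> A \<union> B - (W k' \<union> V j)" for x using that fixA fixB by blast
  qed
  then have "h \<in> cross k' j" using cross_contains_alternating kj even by blast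
  moreover have "g = p \<circ> (q \<circ> h)"
    unfolding h_def by (rule ext) (simp add: bij_is_surj p'(1) q'(1) surj_f_inv_f)
  ultimately show ?thesis using pc qc by (blast intro: words_comp)
qed

lemma cross_Int_left:
  assumes "g \<in> cross k j" "k < m" "g \<in> par \<sigma> {..<m}"
  shows "g \<in> par \<sigma> {k..<m}"
  using cross_left[OF assms(1)] L.tight_mod assms by blast

lemma cross_Int_right:
  assumes "g \<in> cross k j" "j < r" "g \<in> par \<tau> {..<r}"
  shows "g \<in> par \<tau> {j..<r}"
  using cross_right[OF assms(1)] R.tight_mod assms by blast

lemma glue_left: "s < m \<Longrightarrow> glue ` {k..s} = \<sigma> ` {k..s}"
  unfolding glue_def by (intro image_cong) auto

text \<open>The second sequence is reversed: an interval of glued indices that starts at the junction is a final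
segment of its own indices.\<close>
lemma glue_right:
  assumes "m \<le> k" "k \<le> s" "s < m + r"
  shows "glue ` {k..s} = \<tau> ` {m + r - 1 - s..m + r - 1 - k}"
proof -
  have "(\<lambda>i. m + r - 1 - i) ` {k..s} = {m + r - 1 - s..m + r - 1 - k}"
  proof (intro equalityI subsetI)
    fix x assume "x \<in> {m + r - 1 - s..m + r - 1 - k}"
    then show "x \<in> (\<lambda>i. m + r - 1 - i) ` {k..s}"
      using assms by (intro image_eqI[of _ _ "m + r - 1 - x"]) auto
  qed (use assms in auto)
  moreover have "glue ` {k..s} = \<tau> ` (\<lambda>i. m + r - 1 - i) ` {k..s}"
    unfolding image_image glue_def using assms by (intro image_cong) auto
  ultimately show ?thesis by simp
qed

lemma glue_cross:
  assumes "k \<le> m" "m \<le> s" "s < m + r"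
  shows "glue ` {k..s} = \<sigma> ` {k..<m} \<union> \<tau> ` {m + r - 1 - s..<r}"
proof -
  have "{k..s} = {k..m-1} \<union> {m..s}" using assms L.m_pos by auto
  then have "glue ` {k..s} = \<sigma> ` {k..m-1} \<union> \<tau> ` {m + r - 1 - s..m + r - 1 - m}"
    using glue_left[of "m-1" k] glue_right[of m s] assms L.m_pos by (simp add: image_Un)
  moreover have "{k..m-1} = {k..<m}" "{m + r - 1 - s..m + r - 1 - m} = {m + r - 1 - s..<r}"
    using L.m_pos R.m_pos by auto
  ultimately show ?thesis by simp
qed

lemma glue_all: "glue ` {..<m + r} = \<sigma> ` {0..<m} \<union> \<tau> ` {0..<r}"
  using glue_cross[of 0 "m + r - 1"] R.m_pos
  by (simp add: lessThan_atLeast0 atLeastLessThanSuc_atLeastAtMost[symmetric])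

lemma glue_invol: "i < m + r \<Longrightarrow> glue i \<circ> glue i = id"
  unfolding glue_def using L.invol R.invol R.m_pos by simp

lemma glue_comm:
  assumes "i + 2 \<le> j" "j < m + r"
  shows "glue i \<circ> glue j = glue j \<circ> glue i"
proof -
  consider "j < m" | "m \<le> i" | "i < m" "m \<le> j" by linarith
  then show ?thesis
  proof cases
    case 1 then show ?thesis unfolding glue_def using L.comm assms by simp
  next
    case 2
    then have "\<tau> (m + r - 1 - j) \<circ> \<tau> (m + r - 1 - i) = \<tau> (m + r - 1 - i) \<circ> \<tau> (m + r - 1 - j)"
      using assms by (intro R.comm) auto
    then show ?thesis using 2 assms unfolding glue_def by simp
  next
    case 3
    let ?a = "\<sigma> i" and ?b = "\<tau> (m + r - 1 - j)"
    have lt: "i < m" "m + r - 1 - j < r" using 3 assms by auto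
    have disj: "?a x = x \<or> ?b x = x" for x
    proof (cases "x = c")
      case True
      then show ?thesis using L.fixes_c[of i] R.fixes_c[of "m + r - 1 - j"] 3 assms
        by (cases "i + 1 < m") auto
    next
      case False
      then show ?thesis using L.permutes[OF lt(1)] R.permutes[OF lt(2)] meet
        unfolding permutes_def by blast
    qed
    have a: "?a (?a x) = x" and b: "?b (?b x) = x" for x
      using L.invol[OF lt(1)] R.invol[OF lt(2)] by (metis comp_apply id_apply)+
    have "?a (?b x) = ?b (?a x)" for x
      using disj[of x] disj[of "?a x"] disj[of "?b x"] a[of x] b[of x] by metis
    then show ?thesis using 3 unfolding glue_def by (auto simp: fun_eq_iff)
  qed
qed

text \<open>By the reduction to intervals, the intersection of a final interval with an interval that starts
one index earlier has to be found. If both cross the junction, this is lemma \<open>cross_Int\<close>; if only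
one does, tightness moves the element into a final segment of one side, and the intersection
property of that side does the rest. If neither does, then both intervals belong to the right side,
or they are on different sides and the supports of their groups share only \<open>c\<close>.\<close>
theorem glue_intersection_property: "intersection_property glue (m + r)"
proof (rule intersection_property_from_intervals)
  show "glue i \<circ> glue i = id" if "i < m + r" for i using glue_invol that .
  show "glue i \<circ> glue j = glue j \<circ> glue i" if "i + 2 \<le> j" "j < m + r" for i j
    using glue_comm that .
next
  fix k s assume ks: "k \<le> s" "s < m + r"
  have top: "{k<..<m + r} = {Suc k..m + r - 1}" using R.m_pos by auto
  have low: "{k<..s} = {Suc k..s}" by auto
  show "par glue {k<..<m + r} \<inter> par glue {k..s} \<subseteq> par glue {k<..s}"
    unfolding top low
  proof
    fix g assume "g \<in> par glue {Suc k..m + r - 1} \<inter> par glue {k..s}"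
    then have g: "g \<in> par glue {Suc k..m + r - 1}" "g \<in> par glue {k..s}" by blast+
    consider "m \<le> k" | "Suc k = m" "s < m" | "Suc k = m" "m \<le> s"
      | "Suc k < m" "s < m" | "Suc k < m" "m \<le> s" by linarith
    then show "g \<in> par glue {Suc k..s}"
    proof cases
      case 1
      have e1: "glue ` {Suc k..m + r - 1} = \<tau> ` {0..m + r - 1 - Suc k}" if "Suc k < m + r"
        using glue_right[of "Suc k" "m + r - 1"] 1 that by simp
      have e2: "glue ` {k..s} = \<tau> ` {m + r - 1 - s..m + r - 1 - k}"
        using glue_right 1 ks by simp
      show ?thesis
      proof (cases "k = s")
        case True
        show ?thesis
        proof (cases "Suc k = m + r")
          case True
          then show ?thesis using g(1) \<open>k = s\<close> by simp
        next
          case False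
          have "g \<in> par \<tau> {}"
          proof (rule R.par_Int)
            show "g \<in> par \<tau> {0..m + r - 1 - Suc k}" using g(1) e1 ks False by simp
            show "g \<in> par \<tau> {m + r - 1 - s..m + r - 1 - k}" using g(2) e2 by simp
          qed (use 1 ks True False in auto)
          then show ?thesis using True by simp
        qed
      next
        case False
        have e3: "glue ` {Suc k..s} = \<tau> ` {m + r - 1 - s..m + r - 1 - Suc k}"
          using glue_right[of "Suc k" s] 1 ks False by simp
        show ?thesis unfolding e3
        proof (rule R.par_Int)
          show "g \<in> par \<tau> {0..m + r - 1 - Suc k}" using g(1) e1 ks False by simp
          show "g \<in> par \<tau> {m + r - 1 - s..m + r - 1 - k}" using g(2) e2 by simp
        qed (use 1 ks False in auto)
      qed
    next
      case 2
      then have "k = s" using ks by simp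
      have "glue ` {Suc k..m + r - 1} = \<tau> ` {0..<r}"
        using glue_cross[of m "m + r - 1"] 2 R.m_pos by simp
      then have gr: "g \<in> par \<tau> {0..<r}" using g(1) by simp
      have gl: "g \<in> par \<sigma> {k..s}" using g(2) glue_left[OF 2(2), of k] by simp
      have "g = id"
      proof (rule ext)
        fix x
        have gA: "g permutes A" and gB: "g permutes B"
          using L.par_permutes[OF gl] R.par_permutes[OF gr] 2 ks by force+
        show "g x = id x"
        proof (cases "x = c")
          case True
          have "g c \<in> A \<inter> B" using gA gB L.c_in R.c_in by (simp add: permutes_in_image)
          then show ?thesis using meet True by simp
        next
          case False
          then show ?thesis using gA gB meet unfolding permutes_def by auto
        qed
      qed
      then show ?thesis by (simp add: words_id)
    next
      case 3
      have "glue ` {Suc k..m + r - 1} = \<tau> ` {0..<r}"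
        using glue_cross[of m "m + r - 1"] 3 R.m_pos by simp
      then have gr: "g \<in> par \<tau> {..<r}" using g(1) by (simp add: lessThan_atLeast0)
      have "g \<in> cross k (m + r - 1 - s)" using g(2) glue_cross[of k s] 3 ks by simp
      then have "g \<in> par \<tau> {m + r - 1 - s..<r}"
        using cross_Int_right gr 3 ks by simp
      moreover have "glue ` {Suc k..s} = \<tau> ` {m + r - 1 - s..<r}"
        using glue_cross[of m s] 3 ks by simp
      ultimately show ?thesis by simp
    next
      case 4
      have "g \<in> cross (Suc k) 0"
        using glue_cross[of "Suc k" "m + r - 1"] g(1) 4 R.m_pos by simp
      moreover have gl: "g \<in> par \<sigma> {k..s}" using g(2) glue_left[OF 4(2), of k] by simp
      then have "g \<in> par \<sigma> {..<m}" using par_mono[of "{k..s}" "{..<m}" \<sigma>] 4 by force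
      ultimately have "g \<in> par \<sigma> {Suc k..<m}" using cross_Int_left 4 by blast
      then have "g \<in> par \<sigma> {Suc k..s}"
        by (rule L.par_Int[OF _ gl]) (use 4 in auto)
      then show ?thesis using glue_left[OF 4(2)] by simp
    next
      case 5
      have "g \<in> cross (Suc k) 0"
        using glue_cross[of "Suc k" "m + r - 1"] g(1) 5 R.m_pos by simp
      moreover have "g \<in> cross k (m + r - 1 - s)" using g(2) glue_cross[of k s] 5 ks by simp
      ultimately have "g \<in> cross (Suc k) (m + r - 1 - s)"
        using cross_Int[of "Suc k" k "m + r - 1 - s" g 0] 5 ks by simp
      then show ?thesis using glue_cross[of "Suc k" s] 5 ks by simp
    qed
  qed
qed

text \<open>When \<open>c\<close> can be moved to every point of \<open>A\<close> by the left side and to every point of \<open>B\<close> by the right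
side, the orbit on which the glued group is alternating is everything.\<close>
theorem glue_alternating:
  assumes "A \<subseteq> W 0" "B \<subseteq> V 0"
  shows "par glue {..<m + r} = {h. h permutes A \<union> B \<and> evenperm h}"
proof -
  have "W 0 = A" "V 0 = B" using assms L.orbit_subset R.orbit_subset by blast+
  then show ?thesis
    unfolding glue_all using cross_even cross_contains_alternating[of 0 0] L.m_pos R.m_pos by auto
qed

end

section \<open>Permutations of a ladder that preserve its columns\<close>

text \<open>The points \<open>1, 2, 3, \<dots>\<close> are arranged in a ladder with two rows: column \<open>c\<close>, counted from \<open>0\<close>,
consists of \<open>2 * c + 1\<close> in the top row and \<open>2 * c + 2\<close> in the bottom row.\<close>
definition pt :: "nat \<Rightarrow> bool \<Rightarrow> nat" where
  "pt c b = 2 * c + (if b then 2 else 1)"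

lemma pt_eq_iff [simp]: "pt c b = pt c' b' \<longleftrightarrow> c = c' \<and> b = b'"
  unfolding pt_def by (auto split: if_splits) presburger+

lemma pt_cases: obtains "x = 0" | c b where "x = pt c b"
proof (cases "x = 0")
  case False
  have "x = pt ((x - 1) div 2) (even x)" unfolding pt_def using False by (auto elim!: evenE oddE)
  then show thesis using that by blast
qed

text \<open>An element of the wreath product of a group of order 2 with the permutations of the columns: \<open>\<pi>\<close>
moves the columns, and the columns in \<open>v\<close> (named by their position before the move) are turned
upside down. Such elements correspond to monomial matrices with entries \<open>\<plusminus>1\<close>. The number
\<open>0\<close> is not a point of the ladder and stays fixed.\<close>
definition mon :: "(nat \<Rightarrow> nat) \<Rightarrow> nat set \<Rightarrow> nat \<Rightarrow> nat" where
  "mon \<pi> v x = (if x = 0 then 0 else pt (\<pi> ((x - 1) div 2)) (even x \<noteq> ((x - 1) div 2 \<in> v)))"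

lemma mon_0 [simp]: "mon \<pi> v 0 = 0"
  by (simp add: mon_def)

lemma mon_pt [simp]: "mon \<pi> v (pt c b) = pt (\<pi> c) (b \<noteq> (c \<in> v))"
proof -
  have "(pt c b - 1) div 2 = c" "even (pt c b) = b" "pt c b \<noteq> 0" unfolding pt_def by auto
  then show ?thesis unfolding mon_def by simp
qed

lemma fun_eq_pt:
  assumes "f 0 = g 0" "\<And>c b. f (pt c b) = g (pt c b)" shows "f = g"
proof
  fix x show "f x = g x" by (rule pt_cases[of x]) (use assms in auto)
qed

lemma mon_comp: "mon \<pi> u \<circ> mon \<sigma> v = mon (\<pi> \<circ> \<sigma>) {c. (c \<in> v) \<noteq> (\<sigma> c \<in> u)}"
  by (rule fun_eq_pt) auto

lemma mon_eq_iff: "mon \<pi> u = mon \<sigma> v \<longleftrightarrow> \<pi> = \<sigma> \<and> u = v"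
proof
  assume eq: "mon \<pi> u = mon \<sigma> v"
  have "\<pi> c = \<sigma> c \<and> (c \<in> u \<longleftrightarrow> c \<in> v)" for c
    using fun_cong[OF eq, of "pt c False"] by simp
  then show "\<pi> = \<sigma> \<and> u = v" by auto
qed simp

lemma mon_id: "mon id {} = id"
  by (rule fun_eq_pt) auto

abbreviation diag :: "(nat \<Rightarrow> nat) \<Rightarrow> nat \<Rightarrow> nat" where "diag \<pi> \<equiv> mon \<pi> {}"
abbreviation flip :: "nat set \<Rightarrow> nat \<Rightarrow> nat" where "flip v \<equiv> mon id v"
abbreviation adj :: "nat \<Rightarrow> nat \<Rightarrow> nat" where "adj i \<equiv> Transposition.transpose i (Suc i)"

lemma diag_comp: "diag (\<pi> \<circ> \<sigma>) = diag \<pi> \<circ> diag \<sigma>"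
  by (simp add: mon_comp)

lemma transpose_pt: "Transposition.transpose (pt a b) (pt a' b) (pt c d)
    = pt (if d = b then Transposition.transpose a a' c else c) d"
  by (auto simp: Transposition.transpose_def)

lemma transpose_pt_0: "Transposition.transpose (pt a b) (pt a' b') 0 = 0"
  by (simp add: Transposition.transpose_def pt_def)

lemma hgen_eq: "hgen i = diag (adj i)"
proof -
  have pts: "2 * i + 1 = pt i False" "2 * i + 3 = pt (Suc i) False"
      "2 * i + 2 = pt i True" "2 * i + 4 = pt (Suc i) True"
    unfolding pt_def by simp_all
  show ?thesis
    unfolding hgen_def pts by (rule fun_eq_pt) (auto simp: transpose_pt transpose_pt_0)
qed

section \<open>The generators of the three families\<close>

lemma first_points: "Suc 0 = pt 0 False" "2 = pt 0 True" "3 = pt (Suc 0) False" "4 = pt (Suc 0) True"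
  unfolding pt_def by simp_all

lemma flip_01: "Transposition.transpose (Suc 0) 2 \<circ> Transposition.transpose 3 4 = flip {0, Suc 0}"
proof -
  have "Transposition.transpose (pt 0 False) (pt 0 True) \<circ>
      Transposition.transpose (pt (Suc 0) False) (pt (Suc 0) True) = flip {0, Suc 0}"
    by (rule fun_eq_pt) (simp add: transpose_pt_0, auto simp: Transposition.transpose_def)
  then show ?thesis by (simp only: first_points[symmetric])
qed

lemma swap_01: "Transposition.transpose (Suc 0) 3 \<circ> Transposition.transpose 2 4 = diag (adj 0)"
proof -
  have "Transposition.transpose (pt 0 False) (pt (Suc 0) False) \<circ>
      Transposition.transpose (pt 0 True) (pt (Suc 0) True) = diag (adj 0)"
    by (rule fun_eq_pt) (simp_all add: transpose_pt_0 transpose_pt)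
  then show ?thesis by (simp only: first_points[symmetric])
qed

lemma cross_01: "Transposition.transpose (Suc 0) 4 \<circ> Transposition.transpose 2 3 = mon (adj 0) {0, Suc 0}"
proof -
  have "Transposition.transpose (pt 0 False) (pt (Suc 0) True) \<circ>
      Transposition.transpose (pt 0 True) (pt (Suc 0) False) = mon (adj 0) {0, Suc 0}"
    by (rule fun_eq_pt) (simp add: transpose_pt_0, auto simp: Transposition.transpose_def)
  then show ?thesis by (simp only: first_points[symmetric])
qed

lemma gen_X: "family_gen FX i = (if i = 2 then mon (adj 2) {0,1} else diag (adj i))"
proof (cases "i = 2")
  case True
  have "{c. (adj 2 c \<in> {0, Suc 0})} = {0, Suc 0}" by (auto simp: Transposition.transpose_def)
  then show ?thesis using True by (simp add: flip_01 hgen_eq mon_comp)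
qed (simp add: hgen_eq)

text \<open>The involution that distinguishes generator \<open>2\<close> from a plain exchange of neighbouring columns. It
acts on columns \<open>0\<close> and \<open>1\<close> only, so it commutes with all generators from index \<open>2\<close> on; there
the three families can be treated together.\<close>
definition twist :: "family \<Rightarrow> nat \<Rightarrow> nat" where
  "twist Q = (if Q = FX then flip {0,1} else diag (adj 0))"

lemma gen_2: "family_gen Q 2 = twist Q \<circ> diag (adj 2)"
  by (cases Q) (simp_all add: twist_def flip_01 swap_01 hgen_eq comp_assoc)

lemma gen_ge_3: "i \<ge> 3 \<Longrightarrow> family_gen Q i = diag (adj i)"
  by (cases Q) (simp_all add: hgen_eq)

lemma gen_1: "family_gen Q 1 = diag (adj 1)" "family_gen Q (Suc 0) = diag (adj 1)"
  by (cases Q; simp add: hgen_eq)+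

lemma gen_0: "family_gen FX 0 = diag (adj 0)" "family_gen FY 0 = flip {0,1}"
    "family_gen FZ 0 = mon (adj 0) {0,1}"
  by (simp_all add: hgen_eq flip_01 cross_01)

lemma gen_Y: "family_gen FY i = (if i = 0 then flip {0,1}
    else diag (if i = 2 then adj 0 \<circ> adj 2 else adj i))"
  by (simp add: flip_01 swap_01 hgen_eq mon_comp)

lemma gen_Z: "family_gen FZ i = (if i = 0 then mon (adj 0) {0,1}
    else diag (if i = 2 then adj 0 \<circ> adj 2 else adj i))"
  by (simp add: cross_01 swap_01 hgen_eq mon_comp)

declare family_gen.simps [simp del]

lemma gen_in_par: "i \<in> I \<Longrightarrow> \<rho> i \<in> par \<rho> I"
  by (intro words_gen imageI)

lemma words_single:
  assumes "g \<in> words {s}" "s \<circ> s = id" shows "g = id \<or> g = s"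
  using assms(1)
proof induction
  case (words_step s' g)
  then show ?case using assms(2) by (metis comp_id singletonD)
qed simp

text \<open>The shape shared by all generators of the three families. That generator \<open>i\<close> leaves the columns after
\<open>i + 1\<close> alone is the reason why distant generators commute.\<close>
lemma family_gen_mon:
  obtains \<pi> v where "family_gen Q i = mon \<pi> v" "\<And>c. \<pi> (\<pi> c) = c" "\<And>c. \<pi> c \<in> v \<longleftrightarrow> c \<in> v"
    "\<And>c. i + 1 < c \<Longrightarrow> \<pi> c = c \<and> c \<notin> v"
proof (cases Q)
  case FX
  show thesis
    by (rule that[of "adj i" "if i = 2 then {0,1} else {}"])
       (auto simp: FX gen_X Transposition.transpose_def)
next
  case FY
  show thesis
    by (rule that[of "if i = 0 then id else if i = 2 then adj 0 \<circ> adj 2 else adj i" "if i = 0 then {0,1} else {}"])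
       (auto simp: FY gen_Y Transposition.transpose_def)
next
  case FZ
  show thesis
    by (rule that[of "if i = 2 then adj 0 \<circ> adj 2 else adj i" "if i = 0 then {0,1} else {}"])
       (auto simp: FZ gen_Z Transposition.transpose_def)
qed

lemma family_gen_involution: "family_gen Q i \<circ> family_gen Q i = id"
  by (rule family_gen_mon[of Q i]) (auto intro!: fun_eq_pt)

lemma family_gen_0 [simp]: "family_gen Q i 0 = 0"
  by (rule family_gen_mon[of Q i]) simp

lemma family_gen_fixes: "i + 1 < c \<Longrightarrow> family_gen Q i (pt c b) = pt c b"
  by (rule family_gen_mon[of Q i]) simp

lemma par_mon:
  assumes "g \<in> par (family_gen Q) I" obtains \<pi> v where "g = mon \<pi> v"
proof -
  have "\<exists>\<pi> v. g = mon \<pi> v"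
    using assms
  proof induction
    case words_id
    show ?case using mon_id by metis
  next
    case (words_step s g)
    then obtain i where "s = family_gen Q i" by blast
    then show ?case using family_gen_mon[of Q i] words_step mon_comp by metis
  qed
  then show thesis using that by blast
qed

lemma par_fixes:
  assumes "g \<in> par (family_gen Q) {k..<n}" "n < c" shows "g (pt c b) = pt c b"
proof (rule words_fixes[OF assms(1)])
  fix s assume "s \<in> family_gen Q ` {k..<n}"
  then show "s (pt c b) = pt c b" using family_gen_fixes[of _ c Q b] assms(2) by fastforce
qed

lemma family_gen_comm:
  assumes "i + 2 \<le> j"
  shows "family_gen Q i \<circ> family_gen Q j = family_gen Q j \<circ> family_gen Q i"
proof (cases "j = 2")
  case True
  then have "i = 0" using assms by simp
  then show ?thesis unfolding True
    by (cases Q; simp add: gen_X gen_Y gen_Z mon_comp mon_eq_iff del: family_gen.simps)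
       (auto simp: Transposition.transpose_def fun_eq_iff)
next
  case False
  then have j: "family_gen Q j = diag (adj j)" using assms gen_ge_3 by simp
  obtain \<pi> v where \<pi>: "family_gen Q i = mon \<pi> v" "\<And>c. \<pi> (\<pi> c) = c"
    "\<And>c. i + 1 < c \<Longrightarrow> \<pi> c = c \<and> c \<notin> v"
    using family_gen_mon[of Q i] by metis
  have fixed: "\<pi> j = j" "\<pi> (Suc j) = Suc j" "j \<notin> v" "Suc j \<notin> v" using \<pi>(3) assms by auto
  have "\<pi> (adj j c) = adj j (\<pi> c) \<and> (adj j c \<in> v \<longleftrightarrow> c \<in> v)" for c
  proof (cases "c = j \<or> c = Suc j")
    case False
    moreover have "\<pi> c \<noteq> j" "\<pi> c \<noteq> Suc j" using False fixed \<pi>(2)[of c] by auto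
    ultimately show ?thesis by simp
  qed (use fixed in auto)
  then show ?thesis unfolding j \<pi>(1) by (intro fun_eq_pt) auto
qed

text \<open>Exchanges of neighbouring columns generate all permutations of an interval of columns. The
homomorphism \<open>\<Phi>\<close> is needed because the columns of the family X are also permuted after relabelling
one of them.\<close>
lemma adjacents_generate:
  assumes comp: "\<And>p q. \<Phi> (p \<circ> q) = \<Phi> p \<circ> \<Phi> q" and id: "\<Phi> id = id"
    and adj: "\<And>i. a \<le> i \<Longrightarrow> i < b \<Longrightarrow> \<Phi> (adj i) \<in> words S"
    and \<pi>: "\<pi> permutes {a..b}"
  shows "\<Phi> \<pi> \<in> words S"
proof -
  have transposition: "\<Phi> (Transposition.transpose i (Suc (i + d))) \<in> words S" if "a \<le> i" "i + d < b" for i d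
    using that
  proof (induction d)
    case 0
    then show ?case using adj by simp
  next
    case (Suc d)
    let ?t = "adj (Suc (i + d))"
    have "Transposition.transpose i (Suc (i + Suc d)) = ?t \<circ> (Transposition.transpose i (Suc (i + d)) \<circ> ?t)"
      by (auto simp: fun_eq_iff Transposition.transpose_def)
    then have "\<Phi> (Transposition.transpose i (Suc (i + Suc d)))
        = \<Phi> ?t \<circ> (\<Phi> (Transposition.transpose i (Suc (i + d))) \<circ> \<Phi> ?t)"
      by (simp only: comp)
    moreover have "\<Phi> ?t \<in> words S" "\<Phi> (Transposition.transpose i (Suc (i + d))) \<in> words S"
      using Suc adj[of "Suc (i + d)"] by simp_all
    ultimately show ?case by (metis words_comp)
  qed
  show ?thesis using \<pi> finite_atLeastAtMost
  proof (induction rule: permutes_induct)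
    case id
    show ?case using assms(2) words_id by metis
  next
    case (swap x y p)
    have "\<Phi> (Transposition.transpose x y) \<in> words S"
    proof (cases "x < y")
      case True
      then show ?thesis using swap(1,2) transposition[of x "y - x - 1"] by simp
    next
      case False
      then show ?thesis using swap(1-3) transposition[of y "x - y - 1"]
        by (simp add: transpose_commute)
    qed
    then show ?case using swap comp words_comp by metis
  qed
qed

lemma diag_generate:
  assumes "\<And>i. a \<le> i \<Longrightarrow> i < b \<Longrightarrow> diag (adj i) \<in> words S" "\<pi> permutes {a..b}"
  shows "diag \<pi> \<in> words S"
  by (rule adjacents_generate[of diag, OF diag_comp mon_id assms])

section \<open>Subgroups generated from index 2 on\<close>

lemma twist_fixes: "2 \<le> c \<Longrightarrow> twist Q (pt c b) = pt c b"
  by (simp add: twist_def)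

lemma twist_moves: "twist Q (pt 0 b) \<noteq> pt 0 b"
  by (simp add: twist_def)

lemma twist_twist: "twist Q (twist Q x) = x"
  by (rule pt_cases[of x]) (auto simp: twist_def)

lemma twist_comm:
  assumes "\<pi> permutes {2..n}"
  shows "twist Q \<circ> diag \<pi> = diag \<pi> \<circ> twist Q"
proof -
  have "\<pi> 0 = 0" "\<pi> (Suc 0) = Suc 0" using permutes_not_in[OF assms] by auto
  moreover have "2 \<le> \<pi> c" if "2 \<le> c" for c
    using that permutes_in_image[OF assms, of c] permutes_not_in[OF assms, of c] by fastforce
  ultimately have "twist Q (diag \<pi> (pt c b)) = diag \<pi> (twist Q (pt c b))" for c b
    using twist_fixes[of "\<pi> c"] twist_fixes[of c]
    by (cases "2 \<le> c") (auto simp: twist_def not_le less_2_cases_iff)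
  then show ?thesis by (intro fun_eq_pt) (auto simp: twist_def)
qed

lemma tail_ge_3:
  assumes "g \<in> par (family_gen Q) {k..<n}" "3 \<le> k"
  obtains \<pi> where "\<pi> permutes {k..n}" "g = diag \<pi>"
proof -
  have "\<exists>\<pi>. \<pi> permutes {k..n} \<and> g = diag \<pi>"
    using assms(1)
  proof induction
    case words_id
    show ?case using mon_id permutes_id by metis
  next
    case (words_step s g)
    then obtain i \<pi> where i: "k \<le> i" "i < n" "s = family_gen Q i" "\<pi> permutes {k..n}" "g = diag \<pi>"
      by auto
    then have "s \<circ> g = diag (adj i \<circ> \<pi>)" using gen_ge_3 assms(2) by (simp add: diag_comp)
    moreover have "adj i \<circ> \<pi> permutes {k..n}"
      using i by (intro permutes_compose permutes_swap_id) auto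
    ultimately show ?case by blast
  qed
  then show thesis using that by blast
qed

lemma tail_2:
  assumes "g \<in> par (family_gen Q) {2..<n}"
  obtains \<pi> where "\<pi> permutes {2..n}" "g = diag \<pi> \<or> g = twist Q \<circ> diag \<pi>"
proof -
  have "\<exists>\<pi>. \<pi> permutes {2..n} \<and> (g = diag \<pi> \<or> g = twist Q \<circ> diag \<pi>)"
    using assms(1)
  proof induction
    case words_id
    show ?case using mon_id permutes_id by metis
  next
    case (words_step s g)
    obtain i where i: "2 \<le> i" "i < n" "s = family_gen Q i" using words_step(1) by auto
    obtain \<pi> where \<pi>: "\<pi> permutes {2..n}" "g = diag \<pi> \<or> g = twist Q \<circ> diag \<pi>"
      using words_step.IH by blast
    have a: "adj i permutes {2..n}" using i by (intro permutes_swap_id) auto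
    have s: "s = diag (adj i) \<or> s = twist Q \<circ> diag (adj i)"
      using gen_ge_3[of i Q] gen_2[of Q] i by (cases "i = 2") auto
    have p: "adj i \<circ> \<pi> permutes {2..n}" using permutes_compose[OF \<pi>(1) a] .
    have "s \<circ> g = diag (adj i \<circ> \<pi>) \<or> s \<circ> g = twist Q \<circ> diag (adj i \<circ> \<pi>)"
    proof -
      have c: "diag (adj i) (twist Q x) = twist Q (diag (adj i) x)" for x
        using fun_cong[OF twist_comm[OF a], of Q x] by simp
      have "s \<circ> g \<in> {diag (adj i) \<circ> diag \<pi>, twist Q \<circ> (diag (adj i) \<circ> diag \<pi>)}"
        using s \<pi>(2) by (auto simp: fun_eq_iff c twist_twist)
      then show ?thesis by (simp add: diag_comp)
    qed
    then show ?case using p by blast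
  qed
  then show thesis using that by blast
qed

text \<open>Generators \<open>2\<close> and \<open>3\<close> exchange two pairs of neighbouring columns, and the first one also twists. The
third power of their product is trivial on the columns from \<open>2\<close> on and leaves three twists, that is, one.\<close>
lemma twist_in_tail:
  assumes "4 \<le> n" shows "twist Q \<in> par (family_gen Q) {2..<n}"
proof -
  let ?g = "family_gen Q" and ?h2 = "diag (adj 2)" and ?h3 = "diag (adj 3)"
  have "adj 2 permutes {2..4}" "adj 3 permutes {2..4}" by (auto intro!: permutes_swap_id)
  then have c: "?h2 (twist Q x) = twist Q (?h2 x)" "?h3 (twist Q x) = twist Q (?h3 x)" for x
    using fun_cong[OF twist_comm, of _ 4 Q x] by simp_all
  have "adj 2 \<circ> adj 3 \<circ> adj 2 \<circ> adj 3 \<circ> adj 2 \<circ> adj 3 = id"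
    by (auto simp: fun_eq_iff Transposition.transpose_def)
  then have "?h2 \<circ> ?h3 \<circ> ?h2 \<circ> ?h3 \<circ> ?h2 \<circ> ?h3 = id" by (metis diag_comp mon_id)
  then have b: "?h2 (?h3 (?h2 (?h3 (?h2 (?h3 x))))) = x" for x by (metis comp_apply id_apply)
  have "?g 2 \<circ> (?g 3 \<circ> (?g 2 \<circ> (?g 3 \<circ> (?g 2 \<circ> ?g 3)))) = twist Q"
    unfolding gen_2 gen_ge_3[OF order_refl] by (rule ext) (simp only: comp_apply c twist_twist b)
  moreover have "?g 2 \<in> par ?g {2..<n}" "?g 3 \<in> par ?g {2..<n}"
    using assms by (auto intro!: gen_in_par)
  ultimately show ?thesis by (metis words_comp)
qed

lemma adj_in_tail:
  assumes "4 \<le> n" "2 \<le> i" "i < n" shows "diag (adj i) \<in> par (family_gen Q) {2..<n}"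
proof (cases "i = 2")
  case True
  have "diag (adj 2) = twist Q \<circ> family_gen Q 2"
    unfolding gen_2 by (auto simp: fun_eq_iff twist_twist)
  moreover have "family_gen Q 2 \<in> par (family_gen Q) {2..<n}"
    using assms by (auto intro!: gen_in_par)
  ultimately show ?thesis using True twist_in_tail[OF assms(1)] words_comp by metis
next
  case False
  then have "diag (adj i) = family_gen Q i" using gen_ge_3 assms(2) by simp
  then show ?thesis using assms gen_in_par[of i "{2..<n}" "family_gen Q"] by simp
qed

lemma diag_in_tail_ge_3:
  assumes "3 \<le> k" "\<pi> permutes {k..n}" shows "diag \<pi> \<in> par (family_gen Q) {k..<n}"
proof (rule diag_generate[OF _ assms(2)])
  show "diag (adj i) \<in> par (family_gen Q) {k..<n}" if "k \<le> i" "i < n" for i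
    using gen_ge_3[of i Q] that assms(1) gen_in_par[of i "{k..<n}" "family_gen Q"]
    by simp
qed

lemma diag_in_tail_2:
  assumes "4 \<le> n" "\<pi> permutes {2..n}" shows "diag \<pi> \<in> par (family_gen Q) {2..<n}"
  using diag_generate[OF adj_in_tail[OF assms(1)] assms(2)] .

text \<open>Here the elements are permutations of columns, possibly multiplied by the central twist, and an
element of the first group is a permutation of the columns after \<open>k\<close>. The twist is excluded because
it moves column \<open>0\<close>.\<close>
lemma interval_ge_2:
  assumes "2 \<le> k" "k < n" "n \<le> m"
    and g: "g \<in> par (family_gen Q) {Suc k..<m}" "g \<in> par (family_gen Q) {k..<n}"
  shows "g \<in> par (family_gen Q) {Suc k..<n}"
proof -
  obtain \<pi> where \<pi>: "\<pi> permutes {Suc k..m}" "g = diag \<pi>" using tail_ge_3[OF g(1)] assms(1) by auto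
  have "g \<in> par (family_gen Q) {2..<n}" using g(2) par_mono[of "{k..<n}" "{2..<n}"] assms(1) by auto
  then obtain \<sigma> where \<sigma>: "\<sigma> permutes {2..n}" "g = diag \<sigma> \<or> g = twist Q \<circ> diag \<sigma>"
    using tail_2 by blast
  have "\<pi> 0 = 0" "\<sigma> 0 = 0" using permutes_not_in[OF \<pi>(1), of 0] permutes_not_in[OF \<sigma>(1), of 0] by auto
  moreover have "g \<noteq> twist Q \<circ> diag \<sigma>"
  proof
    assume "g = twist Q \<circ> diag \<sigma>"
    then have "g (pt 0 False) = twist Q (pt 0 False)" using \<open>\<sigma> 0 = 0\<close> by simp
    then show False using twist_moves[of Q False] \<pi>(2) \<open>\<pi> 0 = 0\<close> by simp
  qed
  ultimately have "g = diag \<sigma>" using \<sigma>(2) by blast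
  then have "\<sigma> = \<pi>" using \<pi>(2) mon_eq_iff by metis
  have "\<pi> permutes {Suc k..n}"
  proof (rule permutes_superset[OF \<pi>(1)])
    show "\<pi> c = c" if "c \<in> {Suc k..m} - {Suc k..n}" for c
      using permutes_not_in[OF \<sigma>(1), of c] that \<open>\<sigma> = \<pi>\<close> by auto
  qed
  then show ?thesis using \<pi>(2) diag_in_tail_ge_3[of "Suc k"] assms(1) by simp
qed

section \<open>Subgroups generated from index 1 on\<close>

definition swaps_pair :: "'a set \<Rightarrow> 'a set \<Rightarrow> ('a \<Rightarrow> 'a) \<Rightarrow> bool" where
  "swaps_pair P P' g \<longleftrightarrow> (\<forall>x\<in>P. g x \<in> P) \<and> (\<forall>x\<in>P'. g x \<in> P') \<or>
     (\<forall>x\<in>P. g x \<in> P') \<and> (\<forall>x\<in>P'. g x \<in> P)"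

lemma words_swaps_pair:
  assumes "g \<in> words S" "\<And>s. s \<in> S \<Longrightarrow> swaps_pair P P' s"
  shows "swaps_pair P P' g"
  using assms(1)
proof induction
  case words_id
  show ?case unfolding swaps_pair_def by simp
next
  case (words_step s g)
  then show ?case using assms(2)[OF words_step(1)] unfolding swaps_pair_def by auto
qed

lemma par_1_2: "par (family_gen Q) {1..<2} = {id, diag (adj 1)}"
proof -
  have "{1..<2} = {1::nat}" by auto
  then have "par (family_gen Q) {1..<2} = words {diag (adj 1)}" by (simp add: gen_1)
  moreover have "diag (adj 1) \<circ> diag (adj 1) = id"
    using family_gen_involution[of Q 1] by (simp add: gen_1)
  ultimately show ?thesis using words_single words_id words_gen by blast
qed

text \<open>The generators \<open>1\<close> and \<open>2\<close> alone do not generate the twist. The reason is an invariant partition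
of the first eight points into two halves: one point from each column for X, and the outer and the
inner two columns for Y and Z.\<close>
lemma par_1_3_pair:
  assumes "g \<in> par (family_gen Q) {1..<3}"
  shows "Q = FX \<Longrightarrow> swaps_pair {pt 0 False, pt 1 False, pt 2 False, pt 3 True}
          {pt 0 True, pt 1 True, pt 2 True, pt 3 False} g"
    and "Q \<noteq> FX \<Longrightarrow> swaps_pair {pt 0 False, pt 0 True, pt 3 False, pt 3 True}
          {pt 1 False, pt 1 True, pt 2 False, pt 2 True} g"
proof -
  have "{1..<3} = {1,2::nat}" by auto
  then have im: "s = diag (adj 1) \<or> s = family_gen Q 2" if "s \<in> family_gen Q ` {1..<3}" for s
    using that by (auto simp: gen_1)
  show "swaps_pair {pt 0 False, pt 1 False, pt 2 False, pt 3 True}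
          {pt 0 True, pt 1 True, pt 2 True, pt 3 False} g" if "Q = FX"
    by (rule words_swaps_pair[OF assms], drule im)
       (auto simp: swaps_pair_def gen_2 twist_def that Transposition.transpose_def)
  show "swaps_pair {pt 0 False, pt 0 True, pt 3 False, pt 3 True}
          {pt 1 False, pt 1 True, pt 2 False, pt 2 True} g" if "Q \<noteq> FX"
    by (rule words_swaps_pair[OF assms], drule im)
       (auto simp: swaps_pair_def gen_2 twist_def that Transposition.transpose_def)
qed

lemma twist_adj_notin:
  "twist Q \<notin> par (family_gen Q) {1..<3}" "diag (adj 2) \<notin> par (family_gen Q) {1..<3}"
  using par_1_3_pair[of "twist Q" Q] par_1_3_pair[of "diag (adj 2)" Q]
  by (cases "Q = FX"; auto simp: swaps_pair_def twist_def)+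

text \<open>An element of the first group is a permutation of the columns from \<open>2\<close> on, with or without a twist.
The second group acts on no column after \<open>n\<close>, so neither does the element. For \<open>n \<ge> 4\<close> all such
elements are generated by the indices from \<open>2\<close> to \<open>n - 1\<close>. For \<open>n = 2\<close> the twist is excluded because
it moves column \<open>0\<close>, and the invariant partition settles \<open>n = 3\<close>.\<close>
lemma interval_1:
  assumes "1 < n" "n \<le> m"
    and g: "g \<in> par (family_gen Q) {2..<m}" "g \<in> par (family_gen Q) {1..<n}"
  shows "g \<in> par (family_gen Q) {2..<n}"
proof -
  obtain \<pi> where \<pi>: "\<pi> permutes {2..m}" "g = diag \<pi> \<or> g = twist Q \<circ> diag \<pi>"
    using tail_2[OF g(1)] .
  have "\<pi> c = c" if "c \<in> {2..m} - {2..n}" for c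
  proof -
    have "n < c" "2 \<le> c" using that by auto
    moreover have "2 \<le> \<pi> c" using permutes_in_image[OF \<pi>(1), of c] that by auto
    ultimately show ?thesis
      using par_fixes[OF g(2), of c False] \<pi>(2) twist_fixes[of "\<pi> c" Q False] by auto
  qed
  then have \<pi>n: "\<pi> permutes {2..n}" by (rule permutes_superset[OF \<pi>(1)])
  consider "n = 2" | "n = 3" | "4 \<le> n" using assms by linarith
  then show ?thesis
  proof cases
    case 1
    then have "\<pi> = id" using \<pi>n by simp
    then have "g = id \<or> g = twist Q" using \<pi>(2) by (auto simp: mon_id)
    moreover have "g (pt 0 False) = pt 0 False" using g(2)[unfolded 1 par_1_2] by auto
    ultimately have "g = id" using twist_moves by metis
    then show ?thesis by (simp add: words_id)
  next
    case 2
    have "{2..n} = {2, Suc 2}" using 2 by auto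
    then have "\<pi> = id \<or> \<pi> = adj 2" using permutes_doubleton_iff[of \<pi> 2 "Suc 2"] \<pi>n by simp
    then have "g = id \<or> g = twist Q \<or> g = diag (adj 2) \<or> g = family_gen Q 2"
      using \<pi>(2) by (auto simp: mon_id gen_2)
    then have "g = id \<or> g = family_gen Q 2" using twist_adj_notin g(2) 2 by blast
    moreover have "{2..<n} = {2}" using 2 by auto
    ultimately show ?thesis by (auto intro: words_id words_gen)
  next
    case 3
    then show ?thesis
      using \<pi>(2) diag_in_tail_2[OF 3 \<pi>n] twist_in_tail[OF 3] by (auto intro: words_comp)
  qed
qed

section \<open>Subgroups generated from index 0 on: Y and Z\<close>

lemma words_diag:
  assumes "g \<in> words S" "\<And>s. s \<in> S \<Longrightarrow> \<exists>\<sigma>. s = diag \<sigma>" shows "\<exists>\<pi>. g = diag \<pi>"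
  using assms(1)
proof induction
  case words_id
  show ?case using mon_id by metis
next
  case (words_step s g)
  then show ?case using assms(2)[OF words_step(1)] by (metis diag_comp)
qed

text \<open>For Y and Z only generator \<open>0\<close> moves points from one row to the other. So in these families the intersection with the
group generated from index \<open>1\<close> on consists of elements that are determined by their column
permutation.\<close>
lemma rows_YZ:
  assumes "g \<in> par (family_gen Q) {1..<m}" "Q \<noteq> FX"
  shows "\<exists>\<pi>. g = diag \<pi>"
proof (rule words_diag[OF assms(1)])
  fix s assume "s \<in> family_gen Q ` {1..<m}"
  then obtain i where "1 \<le> i" "s = family_gen Q i" by auto
  then show "\<exists>\<sigma>. s = diag \<sigma>" using assms(2) by (cases Q) (auto simp: gen_Y gen_Z)
qed

lemma involution_permutes:
  assumes "\<And>x. p (p x) = x" "\<And>x. x \<notin> S \<Longrightarrow> p x = x" shows "p permutes S"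
  unfolding permutes_def using assms by metis

lemma par_column_permutes:
  assumes "g \<in> par (family_gen Q) {k..<n}"
  shows "\<exists>\<pi> v. \<pi> permutes {0..n} \<and> g = mon \<pi> v"
  using assms
proof induction
  case words_id
  show ?case using mon_id permutes_id by metis
next
  case (words_step s g)
  then obtain i where i: "i < n" "s = family_gen Q i" by auto
  obtain \<pi> v where \<pi>: "\<pi> permutes {0..n}" "g = mon \<pi> v" using words_step.IH by blast
  obtain \<sigma> u where \<sigma>: "family_gen Q i = mon \<sigma> u" "\<And>c. \<sigma> (\<sigma> c) = c"
    "\<And>c. i + 1 < c \<Longrightarrow> \<sigma> c = c \<and> c \<notin> u"
    using family_gen_mon[of Q i] by metis
  have "\<sigma> permutes {0..n}" using \<sigma>(2,3) i(1) by (intro involution_permutes) auto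
  then have "\<sigma> \<circ> \<pi> permutes {0..n}" using \<pi>(1) permutes_compose by blast
  then show ?case using mon_comp i(2) \<sigma>(1) \<pi>(2) by metis
qed

text \<open>Generator \<open>0\<close> of Y moves no column, so the column permutation of an element is one that the other
generators produce as well.\<close>
lemma interval_0_Y:
  assumes g: "g \<in> par (family_gen FY) {1..<m}" "g \<in> par (family_gen FY) {0..<n}"
  shows "g \<in> par (family_gen FY) {1..<n}"
proof -
  have "\<exists>\<pi> v. g = mon \<pi> v \<and> diag \<pi> \<in> par (family_gen FY) {1..<n}"
    using g(2)
  proof induction
    case words_id
    show ?case using mon_id by (metis words.words_id)
  next
    case (words_step s g)
    then obtain \<pi> v where \<pi>: "g = mon \<pi> v" "diag \<pi> \<in> par (family_gen FY) {1..<n}" by blast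
    obtain i where i: "i < n" "s = family_gen FY i" using words_step(1) by auto
    show ?case
    proof (cases "i = 0")
      case True
      then show ?thesis using i \<pi> by (auto simp: gen_Y mon_comp)
    next
      case False
      then obtain \<sigma> where \<sigma>: "s = diag \<sigma>" using i by (auto simp: gen_Y)
      moreover have "s \<in> family_gen FY ` {1..<n}" using i False by auto
      then have "s \<circ> diag \<pi> \<in> par (family_gen FY) {1..<n}" using \<pi>(2) words.words_step by blast
      then have "diag (\<sigma> \<circ> \<pi>) \<in> par (family_gen FY) {1..<n}" using \<sigma> diag_comp by metis
      then show ?thesis using \<sigma> \<pi>(1) by (metis mon_comp)
    qed
  qed
  then show ?thesis using rows_YZ[OF g(1)] mon_eq_iff by (metis family.distinct(1))
qed

lemma diag_in_par_YZ:
  assumes "Q \<noteq> FX" "4 \<le> n" "\<pi> permutes {0..n}" shows "diag \<pi> \<in> par (family_gen Q) {1..<n}"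
proof (rule diag_generate[OF _ assms(3)])
  fix i assume i: "i < n"
  have sub: "par (family_gen Q) {2..<n} \<subseteq> par (family_gen Q) {1..<n}" by (rule par_mono) auto
  consider "i = 0" | "i = 1" | "2 \<le> i" by linarith
  then show "diag (adj i) \<in> par (family_gen Q) {1..<n}"
  proof cases
    case 1
    then show ?thesis using twist_in_tail[OF assms(2), of Q] assms(1) sub by (auto simp: twist_def)
  next
    case 2
    then show ?thesis using gen_in_par[of 1 "{1..<n}" "family_gen Q"] assms(2) by (simp add: gen_1)
  next
    case 3
    then show ?thesis using adj_in_tail[OF assms(2) 3 i, of Q] sub by blast
  qed
qed

lemma gen_2_YZ: "Q \<noteq> FX \<Longrightarrow> family_gen Q 2 = diag (adj 0 \<circ> adj 2)"
  by (simp add: gen_2 twist_def diag_comp)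

text \<open>On columns \<open>0, \<dots>, 3\<close> the generators \<open>1\<close> and \<open>2\<close> of Y and Z generate a dihedral group of order \<open>8\<close>,
the stabilizer of the partition into outer and inner columns. Only the part that preserves the set
of outer columns is treated here; generator \<open>2\<close> exchanges the two sets.\<close>
lemma dihedral_par_1_3:
  assumes "Q \<noteq> FX" and \<sigma>: "\<sigma> permutes {0..3}" "\<sigma> 0 \<in> {0,3}" "\<sigma> 3 \<in> {0,3}"
  shows "diag \<sigma> \<in> par (family_gen Q) {1..<3}"
proof -
  let ?G = "par (family_gen Q) {1..<3}" and ?t = "Transposition.transpose 0 (3::nat)"
  have g: "diag (adj 1) \<in> ?G" "diag (adj 0 \<circ> adj 2) \<in> ?G"
    using gen_in_par[of 1 "{1..<3}" "family_gen Q"] gen_in_par[of 2 "{1..<3}" "family_gen Q"]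
      gen_2_YZ[OF assms(1)] by (simp_all add: gen_1)
  have "?t = (adj 0 \<circ> adj 2) \<circ> (adj 1 \<circ> (adj 0 \<circ> adj 2))"
    by (auto simp: fun_eq_iff Transposition.transpose_def)
  then have t: "diag ?t \<in> ?G" using g by (metis diag_comp words_comp)
  have fix03: "diag \<pi> \<in> ?G" if "\<pi> permutes {0..3}" "\<pi> 0 = 0" "\<pi> 3 = 3" for \<pi>
  proof -
    have "\<pi> permutes {1, Suc 1}"
    proof (rule permutes_superset[OF that(1)])
      show "\<pi> c = c" if "c \<in> {0..3} - {1, Suc 1}" for c
      proof -
        have "c = 0 \<or> c = 3" using that by auto
        then show ?thesis using \<open>\<pi> 0 = 0\<close> \<open>\<pi> 3 = 3\<close> by auto
      qed
    qed
    then have "\<pi> = id \<or> \<pi> = adj 1" by (simp only: permutes_doubleton_iff)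
    then show ?thesis using g(1) mon_id words_id by metis
  qed
  have inj: "\<sigma> 0 \<noteq> \<sigma> 3" using inj_eq[OF permutes_inj[OF \<sigma>(1)], of 0 3] by simp
  show ?thesis
  proof (cases "\<sigma> 0 = 0")
    case True
    then show ?thesis using fix03[OF \<sigma>(1)] \<sigma>(3) inj by auto
  next
    case False
    have "?t permutes {0..3}" by (rule permutes_swap_id) auto
    then have "?t \<circ> \<sigma> permutes {0..3}" using \<sigma>(1) permutes_compose by blast
    moreover have "(?t \<circ> \<sigma>) 0 = 0" "(?t \<circ> \<sigma>) 3 = 3" using False \<sigma>(2,3) inj by auto
    ultimately have "diag (?t \<circ> \<sigma>) \<in> ?G" using fix03 by blast
    moreover have "\<sigma> = ?t \<circ> (?t \<circ> \<sigma>)" by (simp add: fun_eq_iff)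
    ultimately show ?thesis using t by (metis diag_comp words_comp)
  qed
qed

text \<open>For \<open>n \<ge> 4\<close> every column permutation occurs without generator \<open>0\<close>. For \<open>n = 2\<close> and \<open>n = 3\<close> the
generators preserve a set with one point in each column, up to complements if \<open>n = 3\<close>. An element
that also preserves the rows must then permute the columns whose chosen point is in the bottom row
among themselves, or, if \<open>n = 3\<close>, exchange them with the others.\<close>
lemma interval_0_Z:
  assumes "0 < n" and g: "g \<in> par (family_gen FZ) {1..<m}" "g \<in> par (family_gen FZ) {0..<n}"
  shows "g \<in> par (family_gen FZ) {1..<n}"
proof -
  obtain \<pi> where \<pi>: "g = diag \<pi>" using rows_YZ[OF g(1)] by auto
  then have perm: "\<pi> permutes {0..n}" using par_column_permutes[OF g(2)] mon_eq_iff by metis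
  consider "n = 1" | "n = 2" | "n = 3" | "4 \<le> n" using assms(1) by linarith
  then show ?thesis
  proof cases
    case 1
    have "g \<in> words {family_gen FZ 0}" using g(2) 1 by simp
    then have "g = id \<or> g = mon (adj 0) {0,1}" using words_single[of g] family_gen_involution gen_0(3) by metis
    then have "g = id" using \<pi> mon_eq_iff by (metis insert_not_empty)
    then show ?thesis by (simp add: words_id)
  next
    case 2
    \<comment> \<open>Both generators preserve this set. It has one point in the bottom row, and \<open>g\<close> preserves
      the rows, so \<open>g\<close> fixes that point.\<close>
    have "g (pt 0 True) \<in> {pt 0 True, pt 1 False, pt 2 False}"
    proof (rule words_image[OF g(2)])
      fix s y assume "s \<in> family_gen FZ ` {0..<n}" and y: "y \<in> {pt 0 True, pt 1 False, pt 2 False}"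
      then have "s = family_gen FZ 0 \<or> s = family_gen FZ 1" using 2 by (auto simp: less_2_cases_iff)
      then show "s y \<in> {pt 0 True, pt 1 False, pt 2 False}"
        using y by (auto simp: gen_Z Transposition.transpose_def)
    qed simp
    then have "\<pi> 0 = 0" using \<pi> by auto
    have "\<pi> permutes {1, Suc 1}"
    proof (rule permutes_superset[OF perm])
      show "\<pi> c = c" if "c \<in> {0..n} - {1, Suc 1}" for c
      proof -
        have "c = 0" using that 2 by auto
        then show ?thesis using \<open>\<pi> 0 = 0\<close> by simp
      qed
    qed
    then have "\<pi> = id \<or> \<pi> = adj 1" by (simp only: permutes_doubleton_iff)
    then show ?thesis unfolding 2 par_1_2 using \<pi> mon_id by blast
  next
    case 3
    let ?P = "{pt 0 True, pt 1 False, pt 2 False, pt 3 True}"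
    let ?P' = "{pt 0 False, pt 1 True, pt 2 True, pt 3 False}"
    have "swaps_pair ?P ?P' g"
    proof (rule words_swaps_pair[OF g(2)])
      fix s assume "s \<in> family_gen FZ ` {0..<n}"
      then obtain i where "i < 3" "s = family_gen FZ i" using 3 by auto
      moreover from this have "i = 0 \<or> i = 1 \<or> i = 2" by linarith
      ultimately have "s = family_gen FZ 0 \<or> s = family_gen FZ 1 \<or> s = family_gen FZ 2" by blast
      then show "swaps_pair ?P ?P' s"
        by (auto simp: gen_Z swaps_pair_def Transposition.transpose_def)
    qed
    then have or: "\<pi> 0 \<in> {0,3} \<and> \<pi> 3 \<in> {0,3} \<or> \<pi> 0 \<in> {1,2} \<and> \<pi> 3 \<in> {1,2}"
      unfolding swaps_pair_def \<pi> by simp (elim disjE conjE; simp)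
    have perm: "\<pi> permutes {0..3}" using perm 3 by simp
    show ?thesis
    proof (cases "\<pi> 0 \<in> {0,3}")
      case True
      then show ?thesis using dihedral_par_1_3[OF _ perm] or \<pi> 3 by auto
    next
      case False
      let ?a = "adj 0 \<circ> adj 2"
      have "adj 0 permutes {0..3}" "adj 2 permutes {0..3}" by (auto intro!: permutes_swap_id)
      then have "?a \<circ> \<pi> permutes {0..3}" using perm permutes_compose by blast
      moreover have "(?a \<circ> \<pi>) 0 \<in> {0,3}" "(?a \<circ> \<pi>) 3 \<in> {0,3}"
        using or False by (auto simp: Transposition.transpose_def)
      ultimately have "diag (?a \<circ> \<pi>) \<in> par (family_gen FZ) {1..<3}"
        using dihedral_par_1_3[of FZ] by blast
      moreover have "diag ?a \<in> par (family_gen FZ) {1..<3}"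
        using gen_in_par[of 2 "{1..<3}" "family_gen FZ"] gen_2_YZ[of FZ] by simp
      moreover have "?a (?a c) = c" for c by (simp add: Transposition.transpose_def)
      then have "\<pi> = ?a \<circ> (?a \<circ> \<pi>)" by (simp add: fun_eq_iff)
      ultimately show ?thesis using \<pi> 3 by (metis diag_comp words_comp)
    qed
  next
    case 4
    then show ?thesis using diag_in_par_YZ[of FZ n \<pi>] perm \<pi> by simp
  qed
qed

section \<open>Subgroups generated from index 0 on: X\<close>

text \<open>The column permutation \<open>\<pi>\<close> as seen after the two points of column \<open>3\<close> are exchanged, that is, the
conjugate of \<open>diag \<pi>\<close> by \<open>flip {3}\<close>. With this labelling the first three generators of X become
exchanges of neighbouring columns, the last of them combined with the central element that turns
over all four columns. They generate a group of order \<open>48\<close>, the product of a group of order \<open>2\<close> and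
the symmetric group of the four columns.\<close>
definition tilt :: "(nat \<Rightarrow> nat) \<Rightarrow> nat \<Rightarrow> nat" where
  "tilt \<pi> = mon \<pi> {c. (c = 3) \<noteq> (\<pi> c = 3)}"

lemma tilt_comp: "tilt (\<pi> \<circ> \<sigma>) = tilt \<pi> \<circ> tilt \<sigma>"
  unfolding tilt_def by (auto simp: mon_comp mon_eq_iff)

lemma tilt_id: "tilt id = id"
  unfolding tilt_def using mon_id by simp

lemma flip_tilt_comm:
  assumes "\<pi> permutes {0..3}" shows "flip {0..3} (tilt \<pi> x) = tilt \<pi> (flip {0..3} x)"
proof (rule pt_cases[of x])
  fix c b assume "x = pt c b"
  moreover have "\<pi> c \<le> 3 \<longleftrightarrow> c \<le> 3" using permutes_in_image[OF assms, of c] by auto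
  ultimately show ?thesis by (auto simp: tilt_def)
qed (simp add: tilt_def)

lemma flip_flip: "flip v (flip v x) = x"
  by (rule pt_cases[of x]) auto

lemma gen_X_tilt: "family_gen FX 0 = tilt (adj 0)" "family_gen FX (Suc 0) = tilt (adj 1)"
    "family_gen FX 2 = flip {0..3} \<circ> tilt (adj 2)"
  unfolding gen_X tilt_def by (auto simp: mon_comp mon_eq_iff Transposition.transpose_def)

lemma par_X_0_3:
  assumes "g \<in> par (family_gen FX) {0..<3}"
  shows "\<exists>\<pi>. \<pi> permutes {0..3} \<and> (g = tilt \<pi> \<or> g = flip {0..3} \<circ> tilt \<pi>)"
  using assms
proof induction
  case words_id
  show ?case using tilt_id permutes_id by metis
next
  case (words_step s g)
  then obtain i where i: "i < 3" "s = family_gen FX i" by auto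
  moreover from this have "i = 0 \<or> i = Suc 0 \<or> i = 2" by linarith
  ultimately have s: "s = tilt (adj i) \<or> s = flip {0..3} \<circ> tilt (adj i)"
    using gen_X_tilt by auto
  have a: "adj i permutes {0..3}" using i by (intro permutes_swap_id) auto
  obtain \<pi> where \<pi>: "\<pi> permutes {0..3}" "g = tilt \<pi> \<or> g = flip {0..3} \<circ> tilt \<pi>"
    using words_step.IH by blast
  have "s \<circ> g \<in> {tilt (adj i) \<circ> tilt \<pi>, flip {0..3} \<circ> (tilt (adj i) \<circ> tilt \<pi>)}"
    using s \<pi>(2) by (auto simp: fun_eq_iff flip_tilt_comm[OF a, symmetric] flip_flip)
  then have "s \<circ> g = tilt (adj i \<circ> \<pi>) \<or> s \<circ> g = flip {0..3} \<circ> tilt (adj i \<circ> \<pi>)"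
    by (simp add: tilt_comp)
  then show ?case using permutes_compose[OF \<pi>(1) a] by blast
qed

text \<open>The central element is the third power of the product of the generators \<open>1\<close> and \<open>2\<close>.\<close>
lemma tilt_in_par:
  assumes "\<pi> permutes {1..3}"
  shows "tilt \<pi> \<in> par (family_gen FX) {1..<3}" "flip {0..3} \<in> par (family_gen FX) {1..<3}"
proof -
  let ?G = "par (family_gen FX) {1..<3}" and ?z = "flip {0..3}"
  have g: "tilt (adj 1) \<in> ?G" "?z \<circ> tilt (adj 2) \<in> ?G"
    using gen_in_par[of 1 "{1..<3}" "family_gen FX"] gen_in_par[of 2 "{1..<3}" "family_gen FX"]
    by (simp_all add: gen_X_tilt)
  let ?a = "tilt (adj 1)" and ?b = "tilt (adj 2)"
  have "adj 1 permutes {0..3}" "adj 2 permutes {0..3}" by (auto intro!: permutes_swap_id)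
  then have c: "?a (?z x) = ?z (?a x)" "?b (?z x) = ?z (?b x)" for x
    using flip_tilt_comm by simp_all
  have "adj 1 \<circ> adj 2 \<circ> adj 1 \<circ> adj 2 \<circ> adj 1 \<circ> adj 2 = id"
    by (auto simp: fun_eq_iff Transposition.transpose_def)
  then have "?a \<circ> ?b \<circ> ?a \<circ> ?b \<circ> ?a \<circ> ?b = id" by (metis tilt_comp tilt_id)
  then have b: "?a (?b (?a (?b (?a (?b x))))) = x" for x by (metis comp_apply id_apply)
  have "?a \<circ> ((?z \<circ> ?b) \<circ> (?a \<circ> ((?z \<circ> ?b) \<circ> (?a \<circ> (?z \<circ> ?b))))) = ?z"
    by (rule ext) (simp only: comp_apply c flip_flip b)
  then show z: "?z \<in> ?G" using g by (metis words_comp)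
  have "?b = ?z \<circ> (?z \<circ> ?b)" by (simp add: fun_eq_iff flip_flip)
  then have b': "?b \<in> ?G" using z g(2) by (metis words_comp)
  show "tilt \<pi> \<in> ?G"
  proof (rule adjacents_generate[of tilt, OF tilt_comp tilt_id _ assms])
    fix i :: nat assume "1 \<le> i" "i < 3"
    then have "i = 1 \<or> i = 2" by linarith
    then show "tilt (adj i) \<in> ?G" using g(1) b' by blast
  qed
qed

lemma diag_in_par_X:
  assumes "4 \<le> n" "\<pi> permutes {1..n}" shows "diag \<pi> \<in> par (family_gen FX) {1..<n}"
proof (rule diag_generate[OF _ assms(2)])
  fix i assume i: "1 \<le> i" "i < n"
  show "diag (adj i) \<in> par (family_gen FX) {1..<n}"
    using gen_in_par[of 1 "{1..<n}" "family_gen FX"] i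
      adj_in_tail[OF assms(1), of i FX] par_mono[of "{2..<n}" "{1..<n}" "family_gen FX"]
    by (cases "i = 1") (auto simp: gen_1)
qed

lemma flip_in_par_X:
  assumes "4 \<le> n" "a \<le> n" "b \<le> n" "a \<noteq> b"
  shows "flip {a, b} \<in> par (family_gen FX) {1..<n}"
proof -
  let ?G = "par (family_gen FX) {1..<n}"
  have base: "flip {0, 1} \<in> ?G"
    using twist_in_tail[OF assms(1), of FX] par_mono[of "{2..<n}" "{1..<n}" "family_gen FX"]
    by (auto simp: twist_def)
  have zero: "flip {0, c} \<in> ?G" if "1 \<le> c" "c \<le> n" for c
  proof -
    let ?t = "Transposition.transpose 1 c"
    have "diag ?t \<in> ?G"
      by (rule diag_in_par_X[OF assms(1)], rule permutes_swap_id) (use that in auto)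
    moreover have "flip {0, c} = diag ?t \<circ> (flip {0, 1} \<circ> diag ?t)"
      unfolding mon_comp mon_eq_iff using that by (auto simp: fun_eq_iff Transposition.transpose_def)
    ultimately show ?thesis using base by (metis words_comp)
  qed
  consider "a = 0" | "b = 0" | "a \<noteq> 0" "b \<noteq> 0" by blast
  then show ?thesis
  proof cases
    case 1 then show ?thesis using zero[of b] assms by auto
  next
    case 2 then show ?thesis using zero[of a] assms by (auto simp: insert_commute)
  next
    case 3
    have "flip {a, b} = flip {0, a} \<circ> flip {0, b}"
      unfolding mon_comp mon_eq_iff using 3 assms by auto
    then show ?thesis using zero[of a] zero[of b] 3 assms words_comp by fastforce
  qed
qed

text \<open>With four or more generators X contains all column permutations and turns over every even set of
columns. Instead of counting turned columns, the lemma records that turning over just these columns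
is possible without generator \<open>0\<close>; each further generator \<open>2\<close> turns over two more columns.\<close>
lemma par_X_0:
  assumes "4 \<le> n" "g \<in> par (family_gen FX) {0..<n}"
  shows "\<exists>\<pi> v. \<pi> permutes {0..n} \<and> g = mon \<pi> v \<and> flip v \<in> par (family_gen FX) {1..<n}"
  using assms(2)
proof induction
  case words_id
  show ?case using mon_id permutes_id words.words_id by metis
next
  case (words_step s g)
  then obtain i where i: "i < n" "s = family_gen FX i" by auto
  obtain \<sigma> v where \<sigma>: "\<sigma> permutes {0..n}" "g = mon \<sigma> v" "flip v \<in> par (family_gen FX) {1..<n}"
    using words_step.IH by blast
  have "adj i permutes {0..n}" using i by (intro permutes_swap_id) auto
  then have p: "adj i \<circ> \<sigma> permutes {0..n}" using \<sigma>(1) permutes_compose by blast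
  show ?case
  proof (cases "i = 2")
    case False
    then have "s \<circ> g = mon (adj i \<circ> \<sigma>) v" using i \<sigma>(2) by (simp add: gen_X mon_comp)
    then show ?thesis using p \<sigma>(3) by blast
  next
    case True
    obtain a b where ab: "\<sigma> a = 0" "\<sigma> b = 1" using permutes_surj[OF \<sigma>(1)] by (metis surjD)
    have "a \<le> n" "b \<le> n"
      using permutes_in_image[OF \<sigma>(1), of a] permutes_in_image[OF \<sigma>(1), of b] ab assms(1) by auto
    moreover have "a \<noteq> b" using ab by auto
    ultimately have "flip {a, b} \<circ> flip v \<in> par (family_gen FX) {1..<n}"
      using flip_in_par_X[OF assms(1)] \<sigma>(3) words_comp by blast
    moreover have "c \<in> {a, b} \<longleftrightarrow> \<sigma> c \<in> {0, 1}" for c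
      using ab permutes_inj[OF \<sigma>(1)] by (metis injD insert_iff singletonD)
    then have "flip {a, b} \<circ> flip v = flip {c. (c \<in> v) \<noteq> (\<sigma> c \<in> {0, 1})}"
      unfolding mon_comp by (simp add: mon_eq_iff)
    moreover have "s \<circ> g = mon (adj i \<circ> \<sigma>) {c. (c \<in> v) \<noteq> (\<sigma> c \<in> {0, 1})}"
      unfolding i(2) \<sigma>(2) gen_X using True by (simp only: simp_thms mon_comp if_True)
    ultimately show ?thesis using p by metis
  qed
qed

text \<open>In the family X the generators from index \<open>1\<close> on produce the full stabilizer of column \<open>0\<close>. The first
two generators only permute columns, the first three generate the group of order \<open>48\<close> described by
\<open>tilt\<close>, and from four generators on even sets of columns can be turned over freely.\<close>
lemma stabilizer_X:
  assumes "0 < n" and g: "g \<in> par (family_gen FX) {0..<n}" "g (pt 0 False) \<in> {pt 0 False, pt 0 True}"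
  shows "g \<in> par (family_gen FX) {1..<n}"
proof -
  have fix0: "\<pi> permutes {1..n}" if "\<pi> permutes {0..n}" "\<pi> 0 = 0" for \<pi>
  proof (rule permutes_superset[OF that(1)])
    show "\<pi> c = c" if "c \<in> {0..n} - {1..n}" for c
    proof -
      have "c = 0" using that by auto
      then show ?thesis using \<open>\<pi> 0 = 0\<close> by simp
    qed
  qed
  consider "n = 1" | "n = 2" | "n = 3" | "4 \<le> n" using assms(1) by linarith
  then show ?thesis
  proof cases
    case 1
    have "g \<in> words {family_gen FX 0}" using g(1) 1 by simp
    then have "g = id \<or> g = diag (adj 0)" using words_single family_gen_involution gen_0 by metis
    then have "g = id" using g(2) by auto
    then show ?thesis by (simp add: words_id)
  next
    case 2
    obtain \<pi> where \<pi>: "g = diag \<pi>"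
    proof -
      have "\<exists>\<pi>. g = diag \<pi>"
        by (rule words_diag[OF g(1)]) (use 2 in \<open>auto simp: gen_X\<close>)
      then show thesis using that by blast
    qed
    then have "\<pi> permutes {0..n}" using par_column_permutes[OF g(1)] mon_eq_iff by metis
    moreover have "\<pi> 0 = 0" using g(2) \<pi> by auto
    ultimately have "\<pi> permutes {1..2}" using fix0 2 by blast
    moreover have "{1..2} = {1, Suc 1}" by auto
    ultimately have "\<pi> = id \<or> \<pi> = adj 1" using permutes_doubleton_iff[of \<pi> 1 "Suc 1"] by simp
    then show ?thesis unfolding 2 par_1_2 using \<pi> mon_id by blast
  next
    case 3
    obtain \<pi> where \<pi>: "\<pi> permutes {0..3}" "g = tilt \<pi> \<or> g = flip {0..3} \<circ> tilt \<pi>"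
      using par_X_0_3 g(1) 3 by blast
    then have "\<pi> 0 = 0" using g(2) by (auto simp: tilt_def)
    then have "\<pi> permutes {1..3}" using fix0 \<pi>(1) 3 by blast
    then show ?thesis unfolding 3 using tilt_in_par \<pi>(2) words_comp by blast
  next
    case 4
    obtain \<pi> v where \<pi>: "\<pi> permutes {0..n}" "g = mon \<pi> v" "flip v \<in> par (family_gen FX) {1..<n}"
      using par_X_0[OF 4 g(1)] by blast
    have "\<pi> 0 = 0" using g(2) \<pi>(2) by auto
    then have "diag \<pi> \<in> par (family_gen FX) {1..<n}" using fix0 \<pi>(1) diag_in_par_X[OF 4] by blast
    moreover have "g = diag \<pi> \<circ> flip v" unfolding \<pi>(2) mon_comp mon_eq_iff by simp
    ultimately show ?thesis using \<pi>(3) words_comp by blast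
  qed
qed

lemma interval_0_X:
  assumes "0 < n" and g: "g \<in> par (family_gen FX) {1..<m}" "g \<in> par (family_gen FX) {0..<n}"
  shows "g \<in> par (family_gen FX) {1..<n}"
proof (rule stabilizer_X[OF assms(1) g(2)])
  show "g (pt 0 False) \<in> {pt 0 False, pt 0 True}"
    by (rule words_image[OF g(1)]) (auto simp: gen_X)
qed

section \<open>The families as pieces for gluing\<close>

lemma family_interval:
  assumes "k < n" "n \<le> m"
    and g: "g \<in> par (family_gen Q) {Suc k..<m}" "g \<in> par (family_gen Q) {k..<n}"
  shows "g \<in> par (family_gen Q) {Suc k..<n}"
proof -
  consider "k = 0" | "k = 1" | "2 \<le> k" by linarith
  then show ?thesis
  proof cases
    case 1
    then show ?thesis using interval_0_X interval_0_Y interval_0_Z assms by (cases Q) auto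
  next
    case 2
    then show ?thesis using interval_1[of n m g Q] assms by (simp add: numeral_2_eq_2)
  next
    case 3 then show ?thesis using interval_ge_2 assms by blast
  qed
qed

theorem family_intersection_property: "intersection_property (family_gen Q) m"
proof (rule intersection_property_from_intervals)
  show "family_gen Q i \<circ> family_gen Q i = id" for i by (rule family_gen_involution)
  show "family_gen Q i \<circ> family_gen Q j = family_gen Q j \<circ> family_gen Q i" if "i + 2 \<le> j" for i j
    using family_gen_comm that .
  fix k s assume "k \<le> s" "s < m"
  moreover have "{k<..<m} = {Suc k..<m}" "{k..s} = {k..<Suc s}" "{k<..s} = {Suc k..<Suc s}" by auto
  ultimately show "par (family_gen Q) {k<..<m} \<inter> par (family_gen Q) {k..s} \<subseteq> par (family_gen Q) {k<..s}"
    using family_interval[of k "Suc s" m _ Q] by auto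
qed

lemma pt_in_points [simp]: "pt c b \<in> points m \<longleftrightarrow> c \<le> m"
  unfolding points_def pt_def by (cases b) auto

lemma points_pt:
  assumes "x \<in> points m" obtains c b where "c \<le> m" "x = pt c b"
proof (cases x rule: pt_cases)
  case 1
  then show thesis using assms by (simp add: points_def)
next
  case (2 c b)
  then show thesis using assms that by simp
qed

lemma even_double_transposition:
  "a \<noteq> b \<Longrightarrow> c \<noteq> d \<Longrightarrow> evenperm (Transposition.transpose a b \<circ> Transposition.transpose c d)"
  by (simp add: evenperm_comp permutation_swap_id evenperm_swap)

lemma family_gen_even: "evenperm (family_gen Q i)"
proof -
  have p: "permutation (Transposition.transpose a b \<circ> Transposition.transpose c d)" for a b c d :: nat
    by (intro permutation_compose permutation_swap_id)
  have h: "evenperm (hgen i)" "permutation (hgen i)" for i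
    unfolding hgen_def by (rule even_double_transposition; simp) (rule p)
  have e: "evenperm (Transposition.transpose a b \<circ> Transposition.transpose c d \<circ> hgen i)"
    if "a \<noteq> b" "c \<noteq> d" for a b c d i
    using evenperm_comp[OF p h(2)] even_double_transposition[OF that] h(1) by blast
  show ?thesis
    by (cases Q) (simp_all add: family_gen.simps h(1) e even_double_transposition)
qed

lemma family_gen_permutes:
  assumes "i < m" shows "family_gen Q i permutes points m"
proof (rule involution_permutes)
  show "family_gen Q i (family_gen Q i x) = x" for x
    using family_gen_involution[of Q i] by (metis comp_apply id_apply)
  fix x assume "x \<notin> points m"
  then show "family_gen Q i x = x"
    using family_gen_fixes[of i _ Q] assms by (cases rule: pt_cases[of x]) auto
qed

lemma family_gen_fixes_last: "i + 1 < m \<Longrightarrow> family_gen Q i (pt m b) = pt m b"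
  using family_gen_fixes .

lemma family_gen_last:
  assumes "2 \<le> i" shows "family_gen Q i (pt (Suc i) b) = pt i b" "family_gen Q i (pt i b) = pt (Suc i) b"
  using assms gen_2[of Q] gen_ge_3[of i Q]
  by (cases "i = 2"; simp add: twist_fixes)+

text \<open>Except for X with \<open>k = 1\<close>, the generators from a positive index \<open>k\<close> on keep the last point in the
bottom row. So an element that is trivial outside the orbit fixes the top row, hence all columns,
and is the identity. For X with \<open>k = 1\<close> the orbit avoids column \<open>0\<close>, and the stabilizer of that column
is known.\<close>
lemma family_tight:
  assumes "k < m" and g: "g \<in> par (family_gen Q) {..<m}"
    and fixed: "\<And>x. x \<in> points m \<Longrightarrow> x \<notin> word_orbit (family_gen Q ` {k..<m}) (pt m True) \<Longrightarrow> g x = x"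
    and "3 \<le> m"
  shows "g \<in> par (family_gen Q) {k..<m}"
proof -
  let ?O = "word_orbit (family_gen Q ` {k..<m}) (pt m True)"
  have g0: "g \<in> par (family_gen Q) {0..<m}" using g by (simp add: lessThan_atLeast0)
  consider "k = 0" | "Q = FX" "k = 1" | "1 \<le> k" "Q = FX \<Longrightarrow> 2 \<le> k" by linarith
  then show ?thesis
  proof cases
    case 1 then show ?thesis using g0 by simp
  next
    case 2
    have "?O \<subseteq> {pt c b | c b. 1 \<le> c}"
    proof (rule word_orbit_subset)
      fix s y assume "s \<in> family_gen Q ` {k..<m}" "y \<in> {pt c b | c b. 1 \<le> c}"
      then obtain i c b where "1 \<le> i" "s = family_gen FX i" "1 \<le> c" "y = pt c b" using 2 by auto
      moreover from this have "1 \<le> adj i c" by (auto simp: Transposition.transpose_def)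
      ultimately show "s y \<in> {pt c b | c b. 1 \<le> c}" by (auto simp: gen_X)
    qed (use assms(4) in auto)
    then have "pt 0 False \<notin> ?O" by auto
    then have "g (pt 0 False) = pt 0 False" using fixed by simp
    then show ?thesis using stabilizer_X[of m g] g0 2 assms(4) by simp
  next
    case 3
    let ?B = "{pt c True | c. Q = FX \<longrightarrow> 2 \<le> c}"
    have "?O \<subseteq> ?B"
    proof (rule word_orbit_subset)
      fix s y assume "s \<in> family_gen Q ` {k..<m}" "y \<in> ?B"
      then obtain i c where i: "k \<le> i" "s = family_gen Q i" and c: "Q = FX \<longrightarrow> 2 \<le> c" "y = pt c True"
        by auto
      show "s y \<in> ?B"
      proof (cases "Q = FX")
        case True
        then have "2 \<le> i" "2 \<le> c" using 3 i c by auto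
        moreover from this have "2 \<le> adj i c" by (auto simp: Transposition.transpose_def)
        ultimately show ?thesis using i(2) c(2) True by (auto simp: gen_X)
      next
        case False
        then show ?thesis using i c 3(1) by (cases Q) (auto simp: gen_Y gen_Z)
      qed
    qed (use assms(4) in auto)
    then have "pt c False \<notin> ?O" for c by auto
    then have g: "g (pt c False) = pt c False" for c
      using fixed[of "pt c False"] par_fixes[OF g0, of c False] by (cases "c \<le> m") auto
    obtain \<pi> v where \<pi>: "g = mon \<pi> v" using par_mon[OF g0] .
    have "\<pi> c = c \<and> c \<notin> v" for c using g[of c] \<pi> by simp
    then have "g = id" unfolding \<pi> by (intro fun_eq_pt) auto
    then show ?thesis by (simp add: words_id)
  qed
qed

text \<open>The last point is carried down the bottom row to column \<open>0\<close>, there into the top row, and up again.\<close>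
lemma family_transitive:
  assumes "3 \<le> m" shows "points m \<subseteq> word_orbit (family_gen Q ` {0..<m}) (pt m True)"
proof -
  let ?O = "word_orbit (family_gen Q ` {0..<m}) (pt m True)"
  have step: "family_gen Q i x \<in> ?O" if "x \<in> ?O" "i < m" for i x
    using word_orbit_apply[OF gen_in_par that(1), of i] that(2) by auto
  have down: "pt (m - d) True \<in> ?O" if "d \<le> m - 2" for d
    using that
  proof (induction d)
    case 0
    show ?case by (simp add: word_orbit_refl)
  next
    case (Suc d)
    then have "Suc (m - Suc d) = m - d" "2 \<le> m - Suc d" "m - Suc d < m" using assms by auto
    then show ?case using family_gen_last(1)[of "m - Suc d" Q True] step[of "pt (m - d) True" "m - Suc d"] Suc
      by simp
  qed
  have b2: "pt c True \<in> ?O" if "2 \<le> c" "c \<le> m" for c using down[of "m - c"] that by simp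
  have b1: "pt 1 True \<in> ?O"
    using step[OF b2[of 2], of 1] assms by (simp add: gen_1 Transposition.transpose_def)
  have b0: "pt 0 True \<in> ?O"
    using step[OF b1, of 0] step[OF b1, of 2] assms by (cases Q) (auto simp: gen_X gen_2_YZ)
  have t01: "pt 0 False \<in> ?O" "pt 1 False \<in> ?O"
  proof -
    show t0: "pt 0 False \<in> ?O"
      using step[OF b0, of 0] step[OF b1, of 0] step[OF b0, of 2] assms
      by (cases Q) (auto simp: gen_X gen_Y gen_Z)
    show "pt 1 False \<in> ?O"
      using step[OF b0, of 0] step[OF b1, of 0] step[OF t0, of 0] assms
      by (cases Q) (auto simp: gen_X gen_Y gen_Z)
  qed
  have up: "pt (2 + d) False \<in> ?O" if "2 + d \<le> m" for d
    using that
  proof (induction d)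
    case 0
    then show ?case using step[OF t01(2), of 1] assms by (simp add: gen_1 numeral_2_eq_2)
  next
    case (Suc d)
    then show ?case
      using family_gen_last(2)[of "2 + d" Q False] step[of "pt (2 + d) False" "2 + d"] by simp
  qed
  show ?thesis
  proof
    fix x assume "x \<in> points m"
    then obtain c b where x: "c \<le> m" "x = pt c b" by (rule points_pt)
    consider "c = 0" | "c = 1" | "2 \<le> c" by linarith
    then show "x \<in> ?O"
    proof cases
      case 1 then show ?thesis using x b0 t01 by (cases b) auto
    next
      case 2 then show ?thesis using x b1 t01 by (cases b) auto
    next
      case 3
      then have "2 + (c - 2) = c" by simp
      then show ?thesis using 3 x b2[of c] up[of "c - 2"] by (cases b) auto
    qed
  qed
qed

lemma family_end_piece:
  assumes "3 \<le> m" shows "end_piece (points m) (pt m True) (family_gen Q) m"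
proof
  show "finite (points m)" by (simp add: points_def)
  show "family_gen Q (m - 1) (pt m True) \<noteq> pt m True"
    using family_gen_last(1)[of "m - 1" Q True] assms by simp
  show "intersection_property (family_gen Q) m" by (rule family_intersection_property)
qed (use assms family_gen_permutes family_gen_even family_gen_involution family_gen_comm
      family_gen_fixes_last family_tight in auto)

section \<open>Relabelling the points of a piece\<close>

lemma act_along_eq: "act_along e A p = map_permutation A e p"
  unfolding act_along_def map_permutation_def restrict_id_def by (simp add: fun_eq_iff)

lemma map_permutation_inj:
  assumes "inj_on e A" "p permutes A" "q permutes A" "map_permutation A e p = map_permutation A e q"
  shows "p = q"
proof
  fix x show "p x = q x"
  proof (cases "x \<in> A")
    case True
    then have "e (p x) = e (q x)" using assms map_permutation_apply[of e A] by metis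
    then show ?thesis using assms(1-3) True by (simp add: inj_on_eq_iff permutes_in_image)
  next
    case False
    then show ?thesis using assms(2,3) by (simp add: permutes_not_in)
  qed
qed

lemma words_map_permutation:
  assumes "inj_on e A" "\<And>s. s \<in> S \<Longrightarrow> s permutes A"
  shows "words (map_permutation A e ` S) = map_permutation A e ` words S"
proof (intro equalityI subsetI)
  let ?M = "map_permutation A e"
  have comp: "?M (s \<circ> g) = ?M s \<circ> ?M g" if "s \<in> S" "g \<in> words S" for s g
    using map_permutation_compose'[OF assms(1), of g s] words_permutes[OF that(2) assms(2)] assms(2) that(1)
    by blast
  show "g \<in> ?M ` words S" if "g \<in> words (?M ` S)" for g
    using that
  proof induction
    case words_id
    show ?case using map_permutation_id'[OF assms(1)] words.words_id by (metis image_eqI)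
  next
    case (words_step s g)
    then obtain s' g' where *: "s' \<in> S" "s = ?M s'" "g' \<in> words S" "g = ?M g'" by blast
    then have "s \<circ> g = ?M (s' \<circ> g')" using comp by simp
    then show ?case using words.words_step[OF *(1,3)] by (rule image_eqI)
  qed
  show "g \<in> words (?M ` S)" if "g \<in> ?M ` words S" for g
  proof -
    obtain h where "h \<in> words S" "g = ?M h" using \<open>g \<in> ?M ` words S\<close> by blast
    moreover have "?M h \<in> words (?M ` S)" using \<open>h \<in> words S\<close>
    proof induction
      case words_id
      show ?case using map_permutation_id'[OF assms(1)] words.words_id by metis
    next
      case (words_step s h)
      then show ?case using comp words.words_step by (metis imageI)
    qed
    ultimately show ?thesis by simp
  qed
qed

lemma word_orbit_map_permutation:
  assumes "inj_on e A" "\<And>s. s \<in> S \<Longrightarrow> s permutes A" "c \<in> A"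
  shows "word_orbit (map_permutation A e ` S) (e c) = e ` word_orbit S c"
proof -
  have "map_permutation A e g (e c) = e (g c)" if "g \<in> words S" for g
    using map_permutation_apply[OF assms(1) assms(3)] .
  moreover have "words (map_permutation A e ` S) = map_permutation A e ` words S"
    by (rule words_map_permutation[OF assms(1)]) (rule assms(2))
  ultimately show ?thesis
    unfolding word_orbit_def by (simp add: image_image)
qed

lemma end_piece_map:
  assumes "end_piece A c \<rho> m" and e: "inj_on e A"
  shows "end_piece (e ` A) (e c) (\<lambda>i. map_permutation A e (\<rho> i)) m"
proof -
  interpret end_piece A c \<rho> m by fact
  let ?M = "map_permutation A e"
  have img: "(\<lambda>i. ?M (\<rho> i)) ` I = ?M ` (\<rho> ` I)" for I by (simp add: image_image)
  have gens: "s permutes A" if "s \<in> \<rho> ` I" "I \<subseteq> {..<m}" for s I using that permutes by auto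
  have par: "par (\<lambda>i. ?M (\<rho> i)) I = ?M ` par \<rho> I" if "I \<subseteq> {..<m}" for I
    unfolding img by (rule words_map_permutation[OF e]) (rule gens[OF _ that])
  have app: "?M p (e x) = e (p x)" if "p permutes A" "x \<in> A" for p x
    using map_permutation_apply[OF e that(2)] .
  have comp: "?M (p \<circ> q) = ?M p \<circ> ?M q" if "p permutes A" "q permutes A" for p q
    using map_permutation_compose'[OF e] that by blast
  have lt: "m - 1 < m" using m_pos by simp
  show ?thesis
  proof
    show "finite (e ` A)" using finite by simp
    show "e c \<in> e ` A" using c_in by simp
    show "0 < m" by (rule m_pos)
    show "?M (\<rho> i) permutes e ` A" if "i < m" for i
      using map_permutation_permutes[of e A "e ` A"] permutes[OF that] e by (simp add: bij_betw_def)
    show "evenperm (?M (\<rho> i))" if "i < m" for i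
      using evenperm_map_permutation[OF e permutes finite] even that by blast
    show "?M (\<rho> i) \<circ> ?M (\<rho> i) = id" if "i < m" for i
      using comp[OF permutes permutes] invol map_permutation_id'[OF e] that by metis
    show "?M (\<rho> i) \<circ> ?M (\<rho> j) = ?M (\<rho> j) \<circ> ?M (\<rho> i)" if "i + 2 \<le> j" "j < m" for i j
    proof -
      have "i < m" using that by simp
      then show ?thesis using comp permutes comm[OF that] that(2) by metis
    qed
    show "?M (\<rho> i) (e c) = e c" if "i + 1 < m" for i
    proof -
      have "i < m" using that by simp
      then show ?thesis using app[OF permutes c_in] fixes_c[OF that] by metis
    qed
    show "?M (\<rho> (m - 1)) (e c) \<noteq> e c"
    proof -
      have "\<rho> (m - 1) c \<in> A" using permutes[OF lt] c_in by (simp add: permutes_in_image)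
      then show ?thesis
        using app[OF permutes[OF lt] c_in] moves_c inj_on_eq_iff[OF e _ c_in] by metis
    qed
    show "intersection_property (\<lambda>i. ?M (\<rho> i)) m"
      unfolding intersection_property_def
    proof (intro allI impI)
      fix I J assume IJ: "I \<subseteq> {..<m}" "J \<subseteq> {..<m}"
      have "inj_on ?M (par \<rho> I \<union> par \<rho> J)"
        using map_permutation_inj[OF e] par_permutes IJ by (intro inj_onI) blast
      then have "?M ` par \<rho> I \<inter> ?M ` par \<rho> J = ?M ` (par \<rho> I \<inter> par \<rho> J)"
        by (intro inj_on_image_Int[symmetric]) auto
      also have "par \<rho> I \<inter> par \<rho> J = par \<rho> (I \<inter> J)"
        using intersection IJ unfolding intersection_property_def by blast
      finally have "?M ` par \<rho> I \<inter> ?M ` par \<rho> J = ?M ` par \<rho> (I \<inter> J)" .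
      moreover have "I \<inter> J \<subseteq> {..<m}" using IJ by blast
      ultimately show "par (\<lambda>i. ?M (\<rho> i)) I \<inter> par (\<lambda>i. ?M (\<rho> i)) J = par (\<lambda>i. ?M (\<rho> i)) (I \<inter> J)"
        using par IJ by metis
    qed
    show "g \<in> par (\<lambda>i. ?M (\<rho> i)) {k..<m}"
      if k: "k < m" and g: "g \<in> par (\<lambda>i. ?M (\<rho> i)) {..<m}"
        and fixed: "\<And>x. x \<in> e ` A \<Longrightarrow> x \<notin> word_orbit ((\<lambda>i. ?M (\<rho> i)) ` {k..<m}) (e c) \<Longrightarrow> g x = x"
      for k g
    proof -
      have sub: "{k..<m} \<subseteq> {..<m}" by auto
      obtain p where p: "p \<in> par \<rho> {..<m}" "g = ?M p" using g par[of "{..<m}"] by blast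
      have pp: "p permutes A" using par_permutes p(1) by blast
      have orb: "word_orbit ((\<lambda>i. ?M (\<rho> i)) ` {k..<m}) (e c) = e ` word_orbit (\<rho> ` {k..<m}) c"
        unfolding img by (rule word_orbit_map_permutation[OF e _ c_in]) (rule gens[OF _ sub])
      have "p \<in> par \<rho> {k..<m}"
      proof (rule tight[OF k p(1)])
        fix x assume x: "x \<in> A" "x \<notin> word_orbit (\<rho> ` {k..<m}) c"
        then have "e x \<notin> e ` word_orbit (\<rho> ` {k..<m}) c"
          using inj_on_image_mem_iff[OF e x(1) orbit_subset] by blast
        then have "e (p x) = e x" using fixed[of "e x"] orb x(1) app[OF pp x(1)] p(2) by auto
        moreover have "p x \<in> A" using pp x(1) by (simp add: permutes_in_image)
        ultimately show "p x = x" using inj_on_eq_iff[OF e _ x(1)] by blast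
      qed
      then show ?thesis using par[OF sub] p(2) by blast
    qed
  qed
qed

section \<open>The glued groups\<close>

lemma generate_eq_words:
  assumes "S \<subseteq> carrier (sym_group n)" "\<And>s. s \<in> S \<Longrightarrow> s \<circ> s = id"
  shows "generate (sym_group n) S = words S"
proof (intro equalityI subsetI)
  have inv: "inv\<^bsub>sym_group n\<^esub> s = s" if "s \<in> S" for s
  proof -
    have "inv' s = s" using assms(2)[OF that] by (rule inv_unique_comp) (rule assms(2)[OF that])
    then show ?thesis using assms(1) that by auto
  qed
  show "g \<in> words S" if "g \<in> generate (sym_group n) S" for g
    using that
  proof induction
    case (inv h) then show ?case using \<open>\<And>s. s \<in> S \<Longrightarrow> inv\<^bsub>sym_group n\<^esub> s = s\<close> words_gen by metis
  qed (simp_all only: sym_group_one sym_group_mult words_id words_gen words_comp)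
  show "g \<in> generate (sym_group n) S" if "g \<in> words S" for g
    using that
  proof induction
    case words_id
    show ?case by (metis generate.one sym_group_one)
  next
    case (words_step s g)
    then show ?case by (metis generate.eng generate.incl sym_group_mult)
  qed
qed

lemma string_C_group_sym:
  fixes \<phi> :: "nat \<Rightarrow> nat \<Rightarrow> nat"
  assumes perm: "\<And>i. i < N \<Longrightarrow> \<phi> i permutes {1..n}"
    and invol: "\<And>i. i < N \<Longrightarrow> \<phi> i \<circ> \<phi> i = id"
    and comm: "\<And>i j. i + 2 \<le> j \<Longrightarrow> j < N \<Longrightarrow> \<phi> i \<circ> \<phi> j = \<phi> j \<circ> \<phi> i"
    and inter: "intersection_property \<phi> N"
  defines "G \<equiv> subgroup_generated (sym_group n) (\<phi> ` {..<N})"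
  shows "string_C_group G N \<phi>" and "G = (sym_group n)\<lparr>carrier := par \<phi> {..<N}\<rparr>"
proof -
  interpret S: group "sym_group n" by (rule sym_group_is_group)
  have sub: "\<phi> ` I \<subseteq> carrier (sym_group n)" if "I \<subseteq> {..<N}" for I
    using perm that by (auto simp: sym_group_carrier)
  have gen: "generate (sym_group n) (\<phi> ` I) = par \<phi> I" if "I \<subseteq> {..<N}" for I
    using generate_eq_words[OF sub[OF that]] invol that by blast
  have inv: "carrier (sym_group n) \<inter> \<phi> ` {..<N} = \<phi> ` {..<N}" using sub by blast
  show G: "G = (sym_group n)\<lparr>carrier := par \<phi> {..<N}\<rparr>"
    unfolding G_def subgroup_generated_def inv using gen by simp
  have H: "subgroup (par \<phi> {..<N}) (sym_group n)"
    using S.generate_is_subgroup[OF sub[OF order_refl]] gen by simp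
  have genG: "generate G (\<phi> ` I) = par \<phi> I" if "I \<subseteq> {..<N}" for I
  proof -
    have "\<phi> ` I \<subseteq> par \<phi> {..<N}" using that by (auto intro!: gen_in_par)
    then show ?thesis unfolding G using S.generate_consistent[OF _ H] gen[OF that] by blast
  qed
  have grp: "group G" unfolding G using S.subgroup_imp_group[OF H] .
  then have mon: "Group.monoid G" by (rule group.is_monoid)
  have sq: "x [^]\<^bsub>G\<^esub> (2::nat) = x \<circ> x" if "x \<in> carrier G" for x
    using monoid.nat_pow_Suc[OF mon, of x] monoid.nat_pow_0[OF mon, of x]
    by (simp add: numeral_2_eq_2 G sym_group_def)
  have one: "\<one>\<^bsub>G\<^esub> = id" and mult: "(\<otimes>\<^bsub>G\<^esub>) = (\<circ>)" by (simp_all add: G sym_group_def)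
  have mem: "\<phi> i \<in> carrier G" if "i < N" for i using that by (simp add: G gen_in_par)
  have far: "(\<phi> i \<circ> \<phi> j) \<circ> (\<phi> i \<circ> \<phi> j) = id" if "i < N" "j < N" "\<bar>int i - int j\<bar> \<ge> 2" for i j
  proof -
    have "i + 2 \<le> j \<or> j + 2 \<le> i" using that(3) by linarith
    then have "\<phi> i \<circ> \<phi> j = \<phi> j \<circ> \<phi> i" using comm that(1,2) by metis
    then show ?thesis using invol[OF that(1)] invol[OF that(2)] by (metis comp_assoc comp_id)
  qed
  have "sggi G N \<phi>"
    unfolding sggi_def
  proof (intro conjI allI impI)
    show "carrier G = generate G (\<phi> ` {..<N})" using genG[of "{..<N}"] by (simp add: G)
    show "\<phi> i [^]\<^bsub>G\<^esub> (2::nat) = \<one>\<^bsub>G\<^esub>" if "i < N" for i using sq mem invol that one by simp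
    show "(\<phi> i \<otimes>\<^bsub>G\<^esub> \<phi> j) [^]\<^bsub>G\<^esub> (2::nat) = \<one>\<^bsub>G\<^esub>"
      if "i < N" "j < N" "2 \<le> \<bar>int i - int j\<bar>" for i j
    proof -
      have "\<phi> i \<circ> \<phi> j \<in> carrier G" using mem that mult by (metis Group.monoid.m_closed mon)
      then show ?thesis using sq far that one mult by simp
    qed
  qed (use grp mem in auto)
  moreover have "generate G (\<phi> ` I) \<inter> generate G (\<phi> ` J) = generate G (\<phi> ` (I \<inter> J))"
    if "I \<subseteq> {..<N}" "J \<subseteq> {..<N}" for I J
  proof -
    have "I \<inter> J \<subseteq> {..<N}" using that by blast
    then show ?thesis using genG that inter unfolding intersection_property_def by simp
  qed
  ultimately show "string_C_group G N \<phi>" unfolding string_C_group_def by blast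
qed

theorem theorem4p3:
  fixes P Q :: family and m r2 :: nat
  assumes "m \<ge> 3" and "r2 \<ge> 3"
  shows "string_C_group (glued_group P Q m r2) (m + r2) (glued_gen P Q m r2) \<and>
         glued_group P Q m r2 \<cong> alt_group (2*m + 2*r2 + 3)"
proof -
  let ?e = "right_point m r2" and ?n = "2*m + 2*r2 + 3" and ?c = "2*m + 2"
  let ?A = "left_point ` points m" and ?B = "right_point m r2 ` points r2"
  let ?\<sigma> = "\<lambda>i. act_along left_point (points m) (family_gen P i)"
  let ?\<tau> = "\<lambda>j. act_along ?e (points r2) (family_gen Q j)"
  have c: "left_point (pt m True) = ?c" "?e (pt r2 True) = ?c"
    by (simp_all add: left_point_def right_point_def pt_def)
  interpret L: end_piece ?A ?c ?\<sigma> m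
    unfolding act_along_eq c(1)[symmetric]
    by (rule end_piece_map[OF family_end_piece[OF assms(1)] inj_on_left_point])
  interpret R: end_piece ?B ?c ?\<tau> r2
    unfolding act_along_eq c(2)[symmetric]
    by (rule end_piece_map[OF family_end_piece[OF assms(2)] inj_on_right_point])
  interpret glued ?A ?B ?c ?\<sigma> ?\<tau> m r2
  proof
    show "?A \<inter> ?B = {?c}"
      using left_right_point_eq_iff[of _ m _ r2] L.c_in R.c_in by (auto simp: left_point_def)
  qed
  have glue: "glue = glued_gen P Q m r2"
    by (rule ext) (simp add: glue_def glued_gen_def)
  have AB: "?A \<union> ?B = {1..?n}" by (rule glued_points)
  have "glue i permutes {1..?n}" if "i < m + r2" for i
  proof -
    have "glue i \<in> cross 0 0" using gen_in_par[of i "{..<m + r2}" glue] that glue_all by simp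
    then show ?thesis using cross_even(1) AB by metis
  qed
  note sym = string_C_group_sym[OF this glue_invol glue_comm glue_intersection_property]
  have "?A \<subseteq> W 0" "?B \<subseteq> V 0"
  proof -
    have orbit: "word_orbit ((\<lambda>i. act_along e (points k) (family_gen F i)) ` {0..<k}) (e (pt k True))
        = e ` word_orbit (family_gen F ` {0..<k}) (pt k True)" if "inj_on e (points k)" for e F k
    proof -
      have "word_orbit (map_permutation (points k) e ` (family_gen F ` {0..<k})) (e (pt k True))
          = e ` word_orbit (family_gen F ` {0..<k}) (pt k True)"
        by (rule word_orbit_map_permutation[OF that]) (auto simp: family_gen_permutes)
      then show ?thesis by (simp only: act_along_eq image_image)
    qed
    show "?A \<subseteq> W 0"
      using image_mono[OF family_transitive[OF assms(1), of P], of left_point]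
      unfolding orbit[of left_point m P, OF inj_on_left_point, unfolded c(1), symmetric] .
    show "?B \<subseteq> V 0"
      using image_mono[OF family_transitive[OF assms(2), of Q], of ?e]
      unfolding orbit[of ?e r2 Q, OF inj_on_right_point, unfolded c(2), symmetric] .
  qed
  from glue_alternating[OF this] have "par glue {..<m + r2} = {h. h permutes {1..?n} \<and> evenperm h}"
    unfolding AB .
  then have "glued_group P Q m r2 = alt_group ?n"
    using sym(2) unfolding glued_group_def glue alt_group_def by simp
  moreover have "alt_group ?n \<cong> alt_group ?n" by (rule iso_refl)
  ultimately show ?thesis using sym(1) unfolding glued_group_def glue by simp
qed

end
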